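(* There exists a constant $\varepsilon_0>0$ such that for every $\varepsilon\in(0,\varepsilon_0]$, any randomized $\mathsf{LOCAL}$ model algorithm that computes a $(1+\varepsilon)$-approximation for the (unweighted) minimum vertex cover problem in bipartite graphs of maximum degree $3$ requires $\Omega\big(\frac{\log n}{\varepsilon}\big)$ rounds, where $n$ is the number of nodes.
   Context: $\mathsf{LOCAL}$ model: the network is the $n$-node input graph; each node has a unique $O(\log n)$-bit identifier; in synchronous rounds every node can send a message of arbitrary size to each neighbor; local computation is free; at the end each node outputs whether it is in the vertex cover. A $(1+\varepsilon)$-approximation is a vertex cover of size at most $(1+\varepsilon)$ times the minimum size of a vertex cover. *)

theory Defs
  imports "HOL-Probability.Probability"
begin

text \<open>Finite simple graphs given by a vertex set and a set of two-element edges.  The nodes of a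
  network are identified with their (unique) identifiers, so vertices are natural numbers.\<close>

definition simple_graph :: "nat set \<Rightarrow> nat set set \<Rightarrow> bool" where
  "simple_graph V E \<longleftrightarrow> finite V \<and> E \<subseteq> {{u, v} | u v. u \<in> V \<and> v \<in> V \<and> u \<noteq> v}"

definition neighbours :: "nat set set \<Rightarrow> nat \<Rightarrow> nat set" where
  "neighbours E v = {u. {u, v} \<in> E}"

definition bipartite_graph :: "nat set \<Rightarrow> nat set set \<Rightarrow> bool" where
  "bipartite_graph V E \<longleftrightarrow> simple_graph V E \<and>
     (\<exists>X Y. X \<union> Y = V \<and> X \<inter> Y = {} \<and> (\<forall>e\<in>E. \<exists>x\<in>X. \<exists>y\<in>Y. e = {x, y}))"

definition max_degree :: "nat set \<Rightarrow> nat set set \<Rightarrow> nat" where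
  "max_degree V E = Max ((\<lambda>v. card (neighbours E v)) ` V)"

definition vertex_cover :: "nat set \<Rightarrow> nat set set \<Rightarrow> nat set \<Rightarrow> bool" where
  "vertex_cover V E C \<longleftrightarrow> C \<subseteq> V \<and> (\<forall>e\<in>E. e \<inter> C \<noteq> {})"

definition min_vertex_cover_size :: "nat set \<Rightarrow> nat set set \<Rightarrow> nat" where
  "min_vertex_cover_size V E = Min (card ` {C. vertex_cover V E C})"

definition approx_vertex_cover :: "real \<Rightarrow> nat set \<Rightarrow> nat set set \<Rightarrow> nat set \<Rightarrow> bool" where
  "approx_vertex_cover \<alpha> V E C \<longleftrightarrow>
     vertex_cover V E C \<and> real (card C) \<le> \<alpha> * real (min_vertex_cover_size V E)"

text \<open>The LOCAL model.  Messages are finite bit strings of unrestricted length.  Before the first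
  round a node knows the number of nodes, its own identifier, the identifiers of its neighbours
  (which serve as addresses for its messages), and its private random bits.\<close>

type_synonym message = "bool list"

type_synonym inbox = "nat \<rightharpoonup> message"

record local_input =
  node_count :: nat
  own_id :: nat
  neighbour_ids :: "nat set"
  random_bits :: "nat \<Rightarrow> bool"

text \<open>As local computation is free, the behaviour of a node is an arbitrary function of its
  initial knowledge and the list of inboxes of all previous rounds (oldest first):
  \<open>send_msg A x h u\<close> is the message to neighbour \<open>u\<close>, and \<open>in_cover A x h\<close> is the final output.\<close>

record local_algorithm =
  send_msg :: "local_input \<Rightarrow> inbox list \<Rightarrow> nat \<Rightarrow> message"
  in_cover :: "local_input \<Rightarrow> inbox list \<Rightarrow> bool"

definition initial_knowledge ::
    "nat set \<Rightarrow> nat set set \<Rightarrow> (nat \<Rightarrow> nat \<Rightarrow> bool) \<Rightarrow> nat \<Rightarrow> local_input" where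
  "initial_knowledge V E \<omega> v =
     \<lparr>node_count = card V, own_id = v, neighbour_ids = neighbours E v, random_bits = \<omega> v\<rparr>"

primrec history ::
    "local_algorithm \<Rightarrow> nat set \<Rightarrow> nat set set \<Rightarrow> (nat \<Rightarrow> nat \<Rightarrow> bool) \<Rightarrow> nat \<Rightarrow> nat \<Rightarrow> inbox list"
  where
    "history A V E \<omega> 0 = (\<lambda>v. [])"
  | "history A V E \<omega> (Suc t) = (\<lambda>v. history A V E \<omega> t v @
       [\<lambda>u. if u \<in> neighbours E v
            then Some (send_msg A (initial_knowledge V E \<omega> u) (history A V E \<omega> t u) v)
            else None])"

definition computed_set ::
    "local_algorithm \<Rightarrow> nat \<Rightarrow> nat set \<Rightarrow> nat set set \<Rightarrow> (nat \<Rightarrow> nat \<Rightarrow> bool) \<Rightarrow> nat set" where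
  "computed_set A T V E \<omega> =
     {v \<in> V. in_cover A (initial_knowledge V E \<omega> v) (history A V E \<omega> T v)}"

text \<open>Every node has its own infinite sequence of independent fair coin flips.\<close>

definition coin_flips :: "(nat \<Rightarrow> bool) measure" where
  "coin_flips = (\<Pi>\<^sub>M i\<in>UNIV. measure_pmf (bernoulli_pmf (1 / 2)))"

definition node_coins :: "nat set \<Rightarrow> (nat \<Rightarrow> nat \<Rightarrow> bool) measure" where
  "node_coins V = (\<Pi>\<^sub>M v\<in>V. coin_flips)"

text \<open>Identifiers of \<open>O(log n)\<close> bits are numbers below \<open>n ^ k\<close> for a constant \<open>k\<close>.\<close>

definition network :: "nat \<Rightarrow> nat \<Rightarrow> nat set \<Rightarrow> nat set set \<Rightarrow> bool" where
  "network k n V E \<longleftrightarrow> simple_graph V E \<and> card V = n \<and> V \<subseteq> {..<n ^ k}"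

text \<open>On every \<open>n\<close>-node bipartite network of maximum degree 3, algorithm \<open>A\<close> outputs after \<open>T\<close>
  rounds, with probability at least \<open>p\<close>, a \<open>(1 + \<epsilon>)\<close>-approximate minimum vertex cover.  The
  measurability condition says that the output of each node is a random variable.\<close>

definition computes_approx_mvc ::
    "local_algorithm \<Rightarrow> nat \<Rightarrow> nat \<Rightarrow> nat \<Rightarrow> real \<Rightarrow> real \<Rightarrow> bool" where
  "computes_approx_mvc A k n T \<epsilon> p \<longleftrightarrow>
     (\<forall>V E. network k n V E \<and> bipartite_graph V E \<and> max_degree V E = 3 \<longrightarrow>
        (\<forall>v\<in>V. {\<omega> \<in> space (node_coins V). v \<in> computed_set A T V E \<omega>} \<in> sets (node_coins V)) \<and>
        p \<le> measure (node_coins V)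
               {\<omega> \<in> space (node_coins V). approx_vertex_cover (1 + \<epsilon>) V E (computed_set A T V E \<omega>)})"

end

theory Submission
  imports Defs "HOL-Combinatorics.Permutations" "HOL-Real_Asymp.Real_Asymp"
begin

text \<open>
  Take a path of \<open>12 g m\<close> nodes, cut into \<open>m\<close> blocks of length \<open>12 g\<close> with \<open>g\<close> of order \<open>1 / \<epsilon>\<close>,
  and join the middle of block \<open>i\<close> to the start of block \<open>\<pi> i\<close> for a permutation \<open>\<pi>\<close>.  The path has a
  perfect matching, and the even nodes and the odd nodes are both optimal covers.  A cover that takes
  the even nodes in some blocks \<open>S\<close> and the odd nodes in the others pays for every step of the path and
  every arc of \<open>\<pi>\<close> leaving \<open>S\<close>; if \<open>\<pi>\<close> is expanding (a counting argument gives such a \<open>\<pi>\<close>), then a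
  \<open>(1 + \<epsilon>)\<close>-approximation has \<open>card S < m / 3\<close> or \<open>card S > 2 m / 3\<close>.  Pendant edges at even
  (\<open>red\<close>) or odd (\<open>blue\<close>) nodes force the one or the other extreme.

  Change the pendant edges one by one from all red to all blue.  In \<open>T\<close> rounds a node sees at most
  \<open>27 ^ (T div g + 1)\<close> blocks, so the expectation of \<open>card S\<close> moves from almost \<open>m\<close> to almost \<open>0\<close> in small
  steps, and decisions in distant blocks are independent, so \<open>card S\<close> is concentrated
  by Chebyshev's inequality.  If \<open>T\<close> is below a small multiple of \<open>ln n / \<epsilon>\<close>, then in some intermediate
  instance \<open>card S\<close> is close to \<open>m / 2\<close> with probability near 1, so the algorithm fails there.
\<close>

section \<open>An expanding permutation\<close>

definition small_subsets :: "nat \<Rightarrow> nat \<Rightarrow> nat set set" where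
  "small_subsets m d = {D. D \<subseteq> {..<m} \<and> card D \<le> d}"

text \<open>Only exits from \<open>S\<close> count, not entries: along the path a cover pays for a
  switch from even to odd nodes, while the opposite switch is free.\<close>

definition path_cut :: "nat \<Rightarrow> nat set \<Rightarrow> nat set" where
  "path_cut m S = {i \<in> S. Suc i < m \<and> Suc i \<notin> S}"

lemma finite_small_subsets: "finite (small_subsets m d)"
  unfolding small_subsets_def by (rule finite_subset[of _ "Pow {..<m}"]) auto

text \<open>Generating function bound: if each subset \<open>D\<close> weighs
  \<open>x ^ card D\<close>, the total weight is \<open>(1 + x) ^ m\<close>, and every small subset
  contributes at least \<open>x ^ d\<close>.\<close>

lemma card_small_subsets_le:
  fixes x :: real
  assumes "0 < x" "x \<le> 1"
  shows "card (small_subsets m d) * x ^ d \<le> (1 + x) ^ m"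
proof -
  have "card (small_subsets m d) * x ^ d = (\<Sum>D\<in>small_subsets m d. x ^ d)" by simp
  also have "\<dots> \<le> (\<Sum>D\<in>small_subsets m d. x ^ card D)"
    using assms by (intro sum_mono power_decreasing) (auto simp: small_subsets_def)
  also have "\<dots> \<le> (\<Sum>D\<in>Pow {..<m}. x ^ card D)"
    using assms by (intro sum_mono2) (auto simp: small_subsets_def)
  also have "\<dots> = (\<Prod>i<m. x + 1)"
    by (subst prod_add) auto
  also have "\<dots> = (1 + x) ^ m" by (simp add: add.commute)
  finally show ?thesis .
qed

text \<open>Exits from \<open>S\<close> and entries into \<open>S\<close> alternate, so the flips
  are twice the exits up to a correction at the two ends.\<close>

lemma card_flips:
  "card {i. i < n \<and> (i \<in> S) \<noteq> (Suc i \<in> S)} + of_bool (0 \<in> S)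
     = 2 * card {i. i < n \<and> i \<in> S \<and> Suc i \<notin> S} + of_bool (n \<in> S)"
proof (induction n)
  case 0
  then show ?case by simp
next
  case (Suc n)
  have "{i. i < Suc n \<and> (i \<in> S) \<noteq> (Suc i \<in> S)} = (if (n \<in> S) \<noteq> (Suc n \<in> S)
      then insert n {i. i < n \<and> (i \<in> S) \<noteq> (Suc i \<in> S)} else {i. i < n \<and> (i \<in> S) \<noteq> (Suc i \<in> S)})"
    by (auto simp: less_Suc_eq)
  moreover have "{i. i < Suc n \<and> i \<in> S \<and> Suc i \<notin> S} = (if n \<in> S \<and> Suc n \<notin> S
      then insert n {i. i < n \<and> i \<in> S \<and> Suc i \<notin> S} else {i. i < n \<and> i \<in> S \<and> Suc i \<notin> S})"
    by (auto simp: less_Suc_eq)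
  ultimately show ?case using Suc by (auto simp: of_bool_def split: if_splits)
qed

text \<open>A set is determined by whether it contains \<open>0\<close> and by the places where
  membership flips; at most \<open>d\<close> exits allow at most \<open>2 * d + 1\<close>
  flips.\<close>

lemma card_path_cut_le:
  "card {S. S \<subseteq> {..<m} \<and> card (path_cut m S) \<le> d} \<le> 2 * card (small_subsets m (2 * d + 1))"
proof -
  define F where "F S = {i. Suc i < m \<and> (i \<in> S) \<noteq> (Suc i \<in> S)}" for S
  let ?A = "{S. S \<subseteq> {..<m} \<and> card (path_cut m S) \<le> d}"
  have "inj_on (\<lambda>S. (0 \<in> S, F S)) ?A"
  proof (rule inj_onI, clarify)
    fix S S' assume S: "S \<subseteq> {..<m}" "S' \<subseteq> {..<m}" and z: "(0 \<in> S) = (0 \<in> S')" and F: "F S = F S'"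
    have "i < m \<longrightarrow> (i \<in> S) = (i \<in> S')" for i
    proof (induction i)
      case (Suc i)
      have "i \<in> F S \<longleftrightarrow> i \<in> F S'" using F by simp
      then show ?case using Suc by (auto simp: F_def)
    qed (use z in simp)
    then show "S = S'" using S by blast
  qed
  moreover have "(\<lambda>S. (0 \<in> S, F S)) ` ?A \<subseteq> UNIV \<times> small_subsets m (2 * d + 1)"
  proof (clarsimp)
    fix S assume S: "S \<subseteq> {..<m}" "card (path_cut m S) \<le> d"
    have "F S = {i. i < m - 1 \<and> (i \<in> S) \<noteq> (Suc i \<in> S)}"
      "path_cut m S = {i. i < m - 1 \<and> i \<in> S \<and> Suc i \<notin> S}"
      by (auto simp: F_def path_cut_def)
    then have "card (F S) \<le> 2 * d + 1" using card_flips[of "m - 1" S] S(2) by (auto simp: of_bool_def split: if_splits)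
    then show "F S \<in> small_subsets m (Suc (2 * d))" by (auto simp: small_subsets_def F_def)
  qed
  ultimately have "card ?A \<le> card ((UNIV :: bool set) \<times> small_subsets m (2 * d + 1))"
    by (intro card_inj_on_le) (auto simp: finite_small_subsets)
  then show ?thesis by (simp add: card_cartesian_product)
qed

text \<open>Composition with a permutation that carries \<open>U\<close> to \<open>U'\<close> maps
  the first family injectively into the second.\<close>

lemma card_permutations_onto_le:
  fixes m :: nat
  assumes "U \<subseteq> {..<m}" "U' \<subseteq> {..<m}" "card U = card U'"
  shows "card {\<pi>. \<pi> permutes {..<m} \<and> \<pi> ` S = U} \<le> card {\<pi>. \<pi> permutes {..<m} \<and> \<pi> ` S = U'}"
proof -
  have fin: "finite U" "finite U'" using finite_subset[OF assms(1)] finite_subset[OF assms(2)] by simp_all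
  obtain f where f: "bij_betw f U U'"
    using fin assms(3) finite_same_card_bij by blast
  have "card ({..<m} - U) = card ({..<m} - U')"
    using assms fin by (simp add: card_Diff_subset)
  then obtain h where h: "bij_betw h ({..<m} - U) ({..<m} - U')"
    using finite_same_card_bij[of "{..<m} - U" "{..<m} - U'"] by auto
  define \<sigma> where "\<sigma> x = (if x \<in> U then f x else if x < m then h x else x)" for x
  have "bij_betw \<sigma> (U \<union> ({..<m} - U)) (U' \<union> ({..<m} - U'))"
  proof (rule bij_betw_combine)
    show "bij_betw \<sigma> U U'" using f by (rule bij_betw_cong[THEN iffD1, rotated]) (simp add: \<sigma>_def)
    show "bij_betw \<sigma> ({..<m} - U) ({..<m} - U')"
      using h by (rule bij_betw_cong[THEN iffD1, rotated]) (simp add: \<sigma>_def)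
  qed auto
  moreover have "U \<union> ({..<m} - U) = {..<m}" "U' \<union> ({..<m} - U') = {..<m}" using assms by auto
  ultimately have "bij_betw \<sigma> {..<m} {..<m}" by simp
  then have \<sigma>: "\<sigma> permutes {..<m}"
    by (rule bij_imp_permutes) (use assms in \<open>auto simp: \<sigma>_def\<close>)
  have "\<sigma> ` U = U'" using f by (auto simp: \<sigma>_def bij_betw_def)
  show ?thesis
  proof (rule card_inj_on_le[where f = "\<lambda>\<pi>. \<sigma> \<circ> \<pi>"])
    show "inj_on (\<lambda>\<pi>. \<sigma> \<circ> \<pi>) {\<pi>. \<pi> permutes {..<m} \<and> \<pi> ` S = U}"
      using permutes_inj[OF \<sigma>] by (intro inj_onI) (auto simp: fun_eq_iff inj_def)
    show "(\<lambda>\<pi>. \<sigma> \<circ> \<pi>) ` {\<pi>. \<pi> permutes {..<m} \<and> \<pi> ` S = U} \<subseteq> {\<pi>. \<pi> permutes {..<m} \<and> \<pi> ` S = U'}"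
      using \<open>\<sigma> ` U = U'\<close> permutes_compose[OF _ \<sigma>] by (auto simp: image_comp[symmetric])
    show "finite {\<pi>. \<pi> permutes {..<m} \<and> \<pi> ` S = U'}"
      by (rule finite_subset[OF _ finite_permutations[of "{..<m}"]]) auto
  qed
qed

text \<open>A random permutation is equally likely to map \<open>S\<close> onto any set of the same
  size, so each such set has probability at most one over the binomial coefficient.\<close>

lemma card_permutations_onto:
  assumes "S \<subseteq> {..<m}" "U \<subseteq> {..<m}" "card U = card S"
  shows "card {\<pi>. \<pi> permutes {..<m} \<and> \<pi> ` S = U} * (m choose card S) \<le> fact m"
proof -
  let ?K = "{U'. U' \<subseteq> {..<m} \<and> card U' = card S}"
  let ?P = "\<lambda>U. {\<pi>. \<pi> permutes {..<m} \<and> \<pi> ` S = U}"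
  have fin: "finite (?P U')" for U'
    by (rule finite_subset[OF _ finite_permutations[of "{..<m}"]]) auto
  have "card (?P U) * (m choose card S) = (\<Sum>U'\<in>?K. card (?P U))"
    using n_subsets[of "{..<m}" "card S"] by simp
  also have "\<dots> \<le> (\<Sum>U'\<in>?K. card (?P U'))"
    using assms by (intro sum_mono card_permutations_onto_le) auto
  also have "\<dots> = card (\<Union>U'\<in>?K. ?P U')"
    by (intro card_UN_disjoint[symmetric]) (auto simp: fin)
  also have "\<dots> \<le> card {\<pi>. \<pi> permutes {..<m}}"
    by (intro card_mono finite_permutations) auto
  also have "\<dots> = fact m" by (simp add: card_permutations)
  finally show ?thesis .
qed

text \<open>\<open>U\<close> is recovered from \<open>U - S\<close> and \<open>S - U\<close>, and
  equal cardinality makes both differences equally small.\<close>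

lemma card_near_sets_le:
  assumes "S \<subseteq> {..<m}"
  shows "card {U. U \<subseteq> {..<m} \<and> card U = card S \<and> card (U - S) \<le> d} \<le> card (small_subsets m d) ^ 2"
proof -
  let ?A = "{U. U \<subseteq> {..<m} \<and> card U = card S \<and> card (U - S) \<le> d}"
  have "inj_on (\<lambda>U. (U - S, S - U)) ?A" by (rule inj_onI) auto
  moreover have "(\<lambda>U. (U - S, S - U)) ` ?A \<subseteq> small_subsets m d \<times> small_subsets m d"
  proof clarify
    fix U assume U: "U \<subseteq> {..<m}" "card U = card S" "card (U - S) \<le> d"
    have f: "finite U" "finite S" using finite_subset[OF U(1)] finite_subset[OF assms] by simp_all
    have "card (S - U) = card (U - S)"
      using card_le_sym_Diff[of U S] card_le_sym_Diff[of S U] f U(2) by auto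
    then show "U - S \<in> small_subsets m d \<and> S - U \<in> small_subsets m d"
      using U assms by (auto simp: small_subsets_def)
  qed
  ultimately have "card ?A \<le> card (small_subsets m d \<times> small_subsets m d)"
    by (intro card_inj_on_le) (auto simp: finite_small_subsets)
  then show ?thesis by (simp add: card_cartesian_product power2_eq_square)
qed

text \<open>For \<open>2 * s <= m\<close> the bound \<open>(m / s) ^ s\<close> has base at least 2;
  the symmetry of binomial coefficients handles larger \<open>s\<close>.\<close>

lemma binomial_ge_middle:
  assumes "m \<le> 3 * s" "3 * s \<le> 2 * m" "0 < m"
  shows "2 powr (real m / 3) \<le> real (m choose s)"
proof -
  have *: "2 powr (real m / 3) \<le> real (m choose s)" if "m \<le> 3 * s" "2 * s \<le> m" "0 < m" for s
  proof -
    have "2 powr (real m / 3) \<le> 2 powr (real s)" using that by simp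
    also have "\<dots> = 2 ^ s" by (simp add: powr_realpow)
    also have "\<dots> \<le> (real m / real s) ^ s"
      using that by (intro power_mono) (auto simp: field_simps)
    also have "\<dots> \<le> real (m choose s)" using that by (intro binomial_ge_n_over_k_pow_k) auto
    finally show ?thesis .
  qed
  show ?thesis
  proof (cases "2 * s \<le> m")
    case True then show ?thesis using * assms by blast
  next
    case False
    then have "m choose s = m choose (m - s)" using assms by (intro binomial_symmetric) auto
    then show ?thesis using *[of "m - s"] assms False by auto
  qed
qed

text \<open>The left side bounds the number of pairs of a set with few exits and a candidate image
  close to it; one over the right side bounds the probability that a random permutation realises a
  given pair.\<close>

lemma small_subsets_count_lt_binomial:
  assumes "500 \<le> m" "m \<le> 3 * s" "3 * s \<le> 2 * m" and d: "d = m div 1000"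
  shows "2 * card (small_subsets m (2 * d + 1)) * card (small_subsets m d) ^ 2 < m choose s"
proof -
  define n where "n = card (small_subsets m (2 * d + 1))"
  \<comment> \<open>The weight \<open>1 / 64\<close> is a power of 2 and contributes the exponent
    \<open>6 * (2 * d + 1)\<close>; by \<open>(65 / 64) ^ 32 <= 2\<close> the other factor is at
    most \<open>2 powr (m / 32)\<close>.\<close>
  have "real n * (1 / 64) ^ (2 * d + 1) \<le> (1 + 1 / 64) ^ m"
    unfolding n_def by (rule card_small_subsets_le) auto
  then have "real n \<le> (65 / 64) ^ m * 64 ^ (2 * d + 1)"
    by (simp add: field_simps power_divide)
  also have "(65 / 64 :: real) ^ m = (65 / 64) powr m" by (simp add: powr_realpow)
  also have "\<dots> = ((65 / 64) powr 32) powr (real m / 32)" by (subst powr_powr) simp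
  also have "\<dots> \<le> 2 powr (real m / 32)"
  proof (rule powr_mono2)
    have "(65 / 64 :: real) powr 32 = (65 / 64) ^ 32" by (subst powr_realpow[symmetric]) auto
    also have "\<dots> \<le> 2" by (simp add: power_divide)
    finally show "(65 / 64 :: real) powr 32 \<le> 2" .
  qed auto
  also have "(64::real) ^ (2 * d + 1) = (2 ^ 6) ^ (2 * d + 1)" by simp
  also have "\<dots> = 2 ^ (6 * (2 * d + 1))" by (rule power_mult[symmetric])
  also have "\<dots> = 2 powr (6 * (2 * d + 1))" by (subst powr_realpow[symmetric]) auto
  also have "2 powr (real m / 32) * 2 powr (6 * (2 * d + 1)) = 2 powr (real m / 32 + 6 * (2 * d + 1))"
    by (simp add: powr_add)
  finally have n: "real n \<le> 2 powr (real m / 32 + 6 * (2 * d + 1))" by simp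
  have "card (small_subsets m d) \<le> n"
    unfolding n_def by (rule card_mono[OF finite_small_subsets]) (auto simp: small_subsets_def)
  then have "2 * n * card (small_subsets m d) ^ 2 \<le> 2 * n * n ^ 2"
    by (intro mult_mono power_mono) auto
  also have "\<dots> = 2 * n ^ 3" by (simp add: power3_eq_cube power2_eq_square)
  finally have "real (2 * n * card (small_subsets m d) ^ 2) \<le> real (2 * n ^ 3)"
    unfolding of_nat_le_iff .
  also have "\<dots> = 2 * real n ^ 3" by simp
  also have "\<dots> \<le> 2 * (2 powr (real m / 32 + 6 * (2 * d + 1))) ^ 3"
    using n by (intro mult_left_mono power_mono) auto
  also have "(2 powr (real m / 32 + 6 * (2 * d + 1))) ^ 3 = 2 powr (3 * (real m / 32 + 6 * (2 * d + 1)))"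
    by (subst powr_power) (auto simp only: of_nat_numeral mult.commute)
  also have "2 * \<dots> = 2 powr (1 + 3 * (real m / 32 + 6 * (2 * d + 1)))"
    by (subst powr_add) simp
  \<comment> \<open>By \<open>1000 * d <= m\<close> the exponent is at most
    \<open>0.13 * m + 19\<close>, which is below \<open>m / 3\<close> for
    \<open>m >= 500\<close>.\<close>
  also have "\<dots> < 2 powr (real m / 3)"
  proof (rule powr_less_mono)
    have "1000 * d \<le> m" using d by simp
    then have "1000 * real d \<le> real m" by linarith
    moreover have "real m \<ge> 500" using assms by simp
    ultimately show "1 + 3 * (real m / 32 + 6 * (2 * d + 1)) < real m / 3"
      by simp
  qed simp
  also have "\<dots> \<le> real (m choose s)" using binomial_ge_middle assms by auto
  finally show ?thesis unfolding n_def of_nat_less_iff .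
qed

text \<open>Union bound: a bad permutation maps some medium-sized \<open>S\<close> with few exits
  onto a set \<open>U\<close> close to \<open>S\<close>. There are at most \<open>K\<close> such
  pairs, and each is realised by at most \<open>fact m / (K + 1)\<close> permutations.\<close>

lemma exists_expanding_permutation:
  assumes m: "500 \<le> m"
  shows "\<exists>\<pi>. \<pi> permutes {..<m} \<and> (\<forall>S\<subseteq>{..<m}. m \<le> 3 * card S \<and> 3 * card S \<le> 2 * m \<longrightarrow>
           m < 1000 * card (path_cut m S) \<or> m < 1000 * card (\<pi> ` S - S))"
proof -
  define d where "d = m div 1000"
  define K where "K = 2 * card (small_subsets m (2 * d + 1)) * card (small_subsets m d) ^ 2"
  define SS where "SS = {S. S \<subseteq> {..<m} \<and> card (path_cut m S) \<le> d \<and> m \<le> 3 * card S \<and> 3 * card S \<le> 2 * m}"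
  define UU where "UU S = {U. U \<subseteq> {..<m} \<and> card U = card S \<and> card (U - S) \<le> d}" for S
  define P where "P S U = {\<pi>. \<pi> permutes {..<m} \<and> \<pi> ` S = U}" for S U
  define bad where "bad = (\<Union>S\<in>SS. \<Union>U\<in>UU S. P S U)"
  have finS: "finite SS" unfolding SS_def by (rule finite_subset[of _ "Pow {..<m}"]) auto
  have finU: "finite (UU S)" for S unfolding UU_def by (rule finite_subset[of _ "Pow {..<m}"]) auto
  have cS: "card SS \<le> 2 * card (small_subsets m (2 * d + 1))"
  proof -
    have "card SS \<le> card {S. S \<subseteq> {..<m} \<and> card (path_cut m S) \<le> d}"
      by (rule card_mono) (auto simp: SS_def)
    then show ?thesis using card_path_cut_le[of m d] by linarith
  qed
  have P: "card (P S U) * (K + 1) \<le> fact m" if S: "S \<in> SS" and U: "U \<in> UU S" for S U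
  proof -
    have "K + 1 \<le> m choose card S"
      using small_subsets_count_lt_binomial[OF m, of "card S" d] S by (simp add: K_def SS_def d_def)
    then have "card (P S U) * (K + 1) \<le> card (P S U) * (m choose card S)" by (rule mult_left_mono) simp
    also have "\<dots> \<le> fact m"
      unfolding P_def by (rule card_permutations_onto) (use S U in \<open>auto simp: SS_def UU_def\<close>)
    finally show ?thesis .
  qed
  have "card bad \<le> (\<Sum>S\<in>SS. card (\<Union>U\<in>UU S. P S U))"
    unfolding bad_def by (rule card_UN_le[OF finS])
  also have "\<dots> \<le> (\<Sum>S\<in>SS. \<Sum>U\<in>UU S. card (P S U))"
    by (intro sum_mono card_UN_le finU)
  finally have "card bad * (K + 1) \<le> (\<Sum>S\<in>SS. \<Sum>U\<in>UU S. card (P S U)) * (K + 1)"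
    by (rule mult_right_mono) simp
  also have "\<dots> = (\<Sum>S\<in>SS. \<Sum>U\<in>UU S. card (P S U) * (K + 1))"
    by (simp only: sum_distrib_right)
  also have "\<dots> \<le> (\<Sum>S\<in>SS. \<Sum>U\<in>UU S. fact m)"
    by (intro sum_mono P)
  also have "\<dots> = (\<Sum>S\<in>SS. card (UU S)) * fact m" by (simp add: sum_distrib_right)
  also have "\<dots> \<le> (\<Sum>S\<in>SS. card (small_subsets m d) ^ 2) * fact m"
    unfolding UU_def by (intro mult_right_mono sum_mono card_near_sets_le) (auto simp: SS_def)
  also have "\<dots> = card SS * card (small_subsets m d) ^ 2 * fact m" by simp
  also have "\<dots> \<le> K * fact m"
    unfolding K_def using cS by (intro mult_right_mono) auto
  also have "\<dots> < (K + 1) * fact m" by simp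
  finally have "card bad * (K + 1) < fact m * (K + 1)" by (simp only: mult.commute)
  then have "card bad < fact m" unfolding mult_less_cancel2 by blast
  then have "card bad < card {\<pi>. \<pi> permutes {..<m}}"
    by (simp add: card_permutations)
  moreover have "finite bad"
    unfolding bad_def P_def
    by (intro finite_UN_I finS finU finite_subset[OF _ finite_permutations[of "{..<m}"]]) auto
  ultimately obtain \<pi> where \<pi>: "\<pi> permutes {..<m}" "\<pi> \<notin> bad"
    using card_mono[of bad "{\<pi>. \<pi> permutes {..<m}}"] by fastforce
  have "m < 1000 * card (path_cut m S) \<or> m < 1000 * card (\<pi> ` S - S)"
    if S: "S \<subseteq> {..<m}" "m \<le> 3 * card S" "3 * card S \<le> 2 * m" for S
  proof (rule ccontr)
    assume neg: "\<not> ?thesis"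
    have "\<pi> ` S \<subseteq> {..<m}" using S(1) permutes_image[OF \<pi>(1)] by blast
    moreover have "card (\<pi> ` S) = card S"
      using permutes_inj[OF \<pi>(1)] by (intro card_image) (rule inj_on_subset, auto)
    ultimately have "\<pi> ` S \<in> UU S" using neg by (auto simp: UU_def d_def)
    moreover have "S \<in> SS" using S neg by (auto simp: SS_def d_def)
    ultimately show False using \<pi> unfolding bad_def P_def by blast
  qed
  then show ?thesis using \<pi>(1) by blast
qed

section \<open>Concentration\<close>

text \<open>An event that is invariant under changes outside \<open>J\<close> is the preimage of an
  event on the coordinates in \<open>J\<close>, and restrictions to disjoint sets of coordinates are
  independent.\<close>

lemma measure_Int_disjoint_coordinates:
  fixes N :: "'i \<Rightarrow> 'a measure"
  assumes N: "\<And>i. i \<in> I \<Longrightarrow> prob_space (N i)" and JK: "J \<subseteq> I" "K \<subseteq> I" "J \<inter> K = {}"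
    and A: "A \<in> sets (PiM I N)" and B: "B \<in> sets (PiM I N)"
    and dA: "\<And>\<omega> \<omega>'. \<omega> \<in> space (PiM I N) \<Longrightarrow> \<omega>' \<in> space (PiM I N) \<Longrightarrow>
               (\<And>i. i \<in> J \<Longrightarrow> \<omega> i = \<omega>' i) \<Longrightarrow> \<omega> \<in> A \<Longrightarrow> \<omega>' \<in> A"
    and dB: "\<And>\<omega> \<omega>'. \<omega> \<in> space (PiM I N) \<Longrightarrow> \<omega>' \<in> space (PiM I N) \<Longrightarrow>
               (\<And>i. i \<in> K \<Longrightarrow> \<omega> i = \<omega>' i) \<Longrightarrow> \<omega> \<in> B \<Longrightarrow> \<omega>' \<in> B"
  shows "measure (PiM I N) (A \<inter> B) = measure (PiM I N) A * measure (PiM I N) B"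
proof (cases "I = {}")
  case True
  interpret P: prob_space "PiM I N" using N by (rule prob_space_PiM)
  have sp: "space (PiM I N) = {\<lambda>_. undefined}" using True by (simp add: space_PiM)
  have *: "X \<in> sets (PiM I N) \<Longrightarrow> X = {} \<or> X = space (PiM I N)" for X
    using sets.sets_into_space[of X "PiM I N"] sp by auto
  show ?thesis using *[OF A] *[OF B] P.prob_space by auto
next
  case False
  define M where "M = PiM I N"
  interpret P: prob_space M unfolding M_def using N by (rule prob_space_PiM)
  have comp: "distr M (N i) (\<lambda>\<omega>. \<omega> i) = N i" if "i \<in> I" for i
    unfolding M_def using N that by (intro distr_PiM_component) auto
  have "P.indep_vars N (\<lambda>i \<omega>. \<omega> i) I"
  proof (subst P.indep_vars_iff_distr_eq_PiM'[OF False])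
    show "P.random_variable (N i) (\<lambda>\<omega>. \<omega> i)" if "i \<in> I" for i
      unfolding M_def using that by measurable
    have "distr M (PiM I N) (\<lambda>x. restrict x I) = distr M M (\<lambda>x. x)"
      by (intro distr_cong) (auto simp: M_def space_PiM restrict_PiE_iff PiE_restrict)
    also have "\<dots> = M" by (rule distr_id2) simp
    also have "\<dots> = PiM I (\<lambda>i. distr M (N i) (\<lambda>\<omega>. \<omega> i))"
      unfolding M_def by (rule PiM_cong) (auto simp: comp[unfolded M_def])
    finally show "distr M (PiM I N) (\<lambda>x. \<lambda>i\<in>I. x i) = PiM I (\<lambda>i. distr M (N i) (\<lambda>\<omega>. \<omega> i))" .
  qed
  from P.indep_var_restrict[OF this JK(3) JK(1) JK(2)]
  have ind: "P.indep_var (PiM J N) (\<lambda>\<omega>. restrict \<omega> J) (PiM K N) (\<lambda>\<omega>. restrict \<omega> K)" by simp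
  obtain \<eta> where \<eta>: "\<eta> \<in> space M" using P.not_empty by blast
  have ext: "\<exists>X' \<in> sets (PiM L N). X = (\<lambda>\<omega>. restrict \<omega> L) -` X' \<inter> space M"
    if L: "L \<subseteq> I" and X: "X \<in> sets M" and dX: "\<And>\<omega> \<omega>'. \<omega> \<in> space M \<Longrightarrow> \<omega>' \<in> space M \<Longrightarrow>
               (\<And>i. i \<in> L \<Longrightarrow> \<omega> i = \<omega>' i) \<Longrightarrow> \<omega> \<in> X \<Longrightarrow> \<omega>' \<in> X" for L X
  proof -
    \<comment> \<open>Filling up with the coordinates of the fixed point \<open>\<eta>\<close> is a
      measurable right inverse of restriction to \<open>L\<close>; the pullback of \<open>X\<close>
      along it is the required event.\<close>
    define e where "e \<omega> = (\<lambda>i\<in>I. if i \<in> L then \<omega> i else \<eta> i)" for \<omega>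
    have "e \<in> measurable (PiM L N) M"
      unfolding M_def e_def
    proof (rule measurable_restrict)
      fix i assume i: "i \<in> I"
      show "(\<lambda>\<omega>. if i \<in> L then \<omega> i else \<eta> i) \<in> measurable (PiM L N) (N i)"
        using i \<eta> by (cases "i \<in> L")
          (auto simp: M_def space_PiM intro!: measurable_component_singleton measurable_const)
    qed
    then have "e -` X \<inter> space (PiM L N) \<in> sets (PiM L N)" using X by (rule measurable_sets)
    moreover have "X = (\<lambda>\<omega>. restrict \<omega> L) -` (e -` X \<inter> space (PiM L N)) \<inter> space M"
    proof -
      have "\<omega> \<in> X \<longleftrightarrow> e (restrict \<omega> L) \<in> X" if w: "\<omega> \<in> space M" for \<omega>
      proof -
        have "e (restrict \<omega> L) \<in> space M"
          using w \<eta> L by (auto simp: M_def space_PiM e_def PiE_def Pi_def extensional_def)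
        moreover have "i \<in> L \<Longrightarrow> e (restrict \<omega> L) i = \<omega> i" for i using L by (auto simp: e_def)
        ultimately show ?thesis using dX w by metis
      qed
      moreover have "restrict \<omega> L \<in> space (PiM L N)" if "\<omega> \<in> space M" for \<omega>
        using that L by (auto simp: M_def space_PiM PiE_def Pi_def)
      ultimately show ?thesis using sets.sets_into_space[OF X] by auto
    qed
    ultimately show ?thesis by blast
  qed
  obtain A' where A': "A' \<in> sets (PiM J N)" "A = (\<lambda>\<omega>. restrict \<omega> J) -` A' \<inter> space M"
    using ext[OF JK(1), of A] A dA unfolding M_def by blast
  obtain B' where B': "B' \<in> sets (PiM K N)" "B = (\<lambda>\<omega>. restrict \<omega> K) -` B' \<inter> space M"
    using ext[OF JK(2), of B] B dB unfolding M_def by blast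
  have "A \<inter> B = (\<lambda>x. (restrict x J, restrict x K)) -` (A' \<times> B') \<inter> space M"
    unfolding A'(2) B'(2) by auto
  then show ?thesis
    using P.indep_varD[OF ind A'(1) B'(1)] A'(2) B'(2) by (simp add: M_def)
qed

text \<open>Chebyshev's inequality: the variance is the sum of all covariances. An independent pair
  contributes \<open>0\<close>, any other pair at most \<open>1\<close>, and each \<open>i\<close>
  occurs in at most \<open>D\<close> pairs of the second kind.\<close>

lemma (in prob_space) prob_card_deviation_le:
  assumes I: "finite I" and A: "\<And>i. i \<in> I \<Longrightarrow> A i \<in> events" and a: "0 < a"
    and D: "\<And>i. i \<in> I \<Longrightarrow> card {j \<in> I. prob (A i \<inter> A j) \<noteq> prob (A i) * prob (A j)} \<le> D"
  shows "prob {\<omega> \<in> space M. a \<le> \<bar>real (card {i \<in> I. \<omega> \<in> A i}) - (\<Sum>i\<in>I. prob (A i))\<bar>}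
           \<le> real (card I) * real D / a\<^sup>2"
proof -
  define f where "f \<omega> = (\<Sum>i\<in>I. indicator (A i) \<omega> :: real)" for \<omega>
  have f: "f \<omega> = real (card {i \<in> I. \<omega> \<in> A i})" for \<omega>
    using I by (simp add: f_def indicator_def sum.If_cases Int_def)
  have int: "integrable M (indicator (A i) :: 'a \<Rightarrow> real)" if "i \<in> I" for i
    using A[OF that] by (simp add: integrable_indicator_iff emeasure_eq_measure)
  have Ef: "expectation f = (\<Sum>i\<in>I. prob (A i))"
    unfolding f_def using int A by (subst Bochner_Integration.integral_sum) (auto intro!: sum.cong)
  have rv [measurable]: "random_variable borel f"
    unfolding f_def using A by (intro borel_measurable_sum) auto
  have sq: "(f \<omega>)\<^sup>2 = (\<Sum>i\<in>I. \<Sum>j\<in>I. indicator (A i \<inter> A j) \<omega>)" for \<omega>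
    by (simp add: f_def power2_eq_square sum_product indicator_inter_arith)
  have int2: "integrable M (indicator (A i \<inter> A j) :: 'a \<Rightarrow> real)" if "i \<in> I" "j \<in> I" for i j
    using A that by (simp add: integrable_indicator_iff emeasure_eq_measure)
  have intsq: "integrable M (\<lambda>\<omega>. (f \<omega>)\<^sup>2)"
    unfolding sq using int2 by (intro Bochner_Integration.integrable_sum) auto
  have intf: "integrable M f" unfolding f_def using int by (intro Bochner_Integration.integrable_sum) auto
  have "variance f = expectation (\<lambda>\<omega>. (f \<omega>)\<^sup>2) - (expectation f)\<^sup>2"
    by (rule variance_eq[OF intf intsq])
  also have "expectation (\<lambda>\<omega>. (f \<omega>)\<^sup>2) = (\<Sum>i\<in>I. \<Sum>j\<in>I. prob (A i \<inter> A j))"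
    unfolding sq using int2 A
    by (subst Bochner_Integration.integral_sum, simp, intro sum.cong refl, subst Bochner_Integration.integral_sum)
       (auto intro!: sum.cong)
  also have "(expectation f)\<^sup>2 = (\<Sum>i\<in>I. \<Sum>j\<in>I. prob (A i) * prob (A j))"
    by (simp add: Ef power2_eq_square sum_product)
  also have "(\<Sum>i\<in>I. \<Sum>j\<in>I. prob (A i \<inter> A j)) - (\<Sum>i\<in>I. \<Sum>j\<in>I. prob (A i) * prob (A j))
      = (\<Sum>i\<in>I. \<Sum>j\<in>I. prob (A i \<inter> A j) - prob (A i) * prob (A j))"
    by (simp add: sum_subtractf)
  also have "\<dots> \<le> (\<Sum>i\<in>I. \<Sum>j\<in>I. of_bool (prob (A i \<inter> A j) \<noteq> prob (A i) * prob (A j)))"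
  proof (intro sum_mono)
    fix i j
    have "prob (A i \<inter> A j) - prob (A i) * prob (A j) \<le> 1"
      by (smt (verit) measure_nonneg mult_nonneg_nonneg prob_le_1)
    then show "prob (A i \<inter> A j) - prob (A i) * prob (A j)
        \<le> of_bool (prob (A i \<inter> A j) \<noteq> prob (A i) * prob (A j))" by simp
  qed
  also have "\<dots> = (\<Sum>i\<in>I. real (card {j \<in> I. prob (A i \<inter> A j) \<noteq> prob (A i) * prob (A j)}))"
    using I by (simp add: of_bool_def sum.If_cases Int_def)
  also have "\<dots> \<le> (\<Sum>i\<in>I. real D)" using D by (intro sum_mono) simp
  also have "\<dots> = real (card I) * real D" by simp
  finally have "variance f \<le> real (card I) * real D" .
  then have "variance f / a\<^sup>2 \<le> real (card I) * real D / a\<^sup>2" by (rule divide_right_mono) simp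
  moreover have "prob {\<omega> \<in> space M. a \<le> \<bar>f \<omega> - expectation f\<bar>} \<le> variance f / a\<^sup>2"
    by (rule Chebyshev_inequality[OF rv intsq a])
  ultimately show ?thesis unfolding Ef f by linarith
qed

text \<open>Discrete intermediate value argument: the first value that is at most \<open>b\<close>
  comes after a value above \<open>b\<close>, and a step of at most \<open>b - a\<close> cannot jump
  over the interval.\<close>

lemma exists_in_middle:
  fixes \<mu> :: "nat \<Rightarrow> real"
  assumes "\<mu> 0 > b" "\<mu> n < a" "\<And>j. j < n \<Longrightarrow> \<bar>\<mu> (Suc j) - \<mu> j\<bar> \<le> b - a" "a \<le> b"
  shows "\<exists>j\<le>n. a \<le> \<mu> j \<and> \<mu> j \<le> b"
proof -
  define j where "j = (LEAST j. \<mu> j \<le> b)"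
  have "\<mu> n \<le> b" using assms(1,2,4) by simp
  then have j: "\<mu> j \<le> b" "j \<le> n" unfolding j_def by (auto intro: LeastI Least_le)
  obtain i where i: "j = Suc i" using j assms(1) by (cases j) auto
  have "\<mu> i > b" using not_less_Least[of i "\<lambda>j. \<mu> j \<le> b"] i unfolding j_def by auto
  then have "a \<le> \<mu> j" using assms(3)[of i] i j by auto
  then show ?thesis using j by blast
qed

text \<open>The mean count descends from above \<open>7 * m / 12\<close> to below
  \<open>5 * m / 12\<close> in steps of at most \<open>m / 6\<close>, so for some \<open>j\<close>
  it lies in between. An outcome in \<open>G j\<close> within \<open>m / 12\<close> of this mean has
  a count between \<open>m / 3\<close> and \<open>2 * m / 3\<close>, against
  \<open>gap\<close>.\<close>

lemma (in prob_space) concentrated_count_no_jump: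
  fixes A :: "nat \<Rightarrow> nat \<Rightarrow> 'a set" and m n D :: nat
  assumes A: "\<And>i j. j \<le> n \<Longrightarrow> i < m \<Longrightarrow> A j i \<in> events"
    and D: "\<And>i j. j \<le> n \<Longrightarrow> i < m \<Longrightarrow>
        card {i' \<in> {..<m}. prob (A j i \<inter> A j i') \<noteq> prob (A j i) * prob (A j i')} \<le> D"
    and step: "\<And>j. j < n \<Longrightarrow> card {i \<in> {..<m}. A (Suc j) i \<noteq> A j i} \<le> D"
    and large: "144 * real D < p * real m" and "0 < m" "p \<le> 1"
    and G: "\<And>j. j \<le> n \<Longrightarrow> p \<le> prob (G j)" "\<And>j. j \<le> n \<Longrightarrow> G j \<subseteq> space M"
    and gap: "\<And>j \<omega>. j \<le> n \<Longrightarrow> \<omega> \<in> G j \<Longrightarrow>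
        3 * card {i \<in> {..<m}. \<omega> \<in> A j i} < m \<or> 2 * m < 3 * card {i \<in> {..<m}. \<omega> \<in> A j i}"
    and start: "\<And>\<omega>. \<omega> \<in> G 0 \<Longrightarrow> 2 * m < 3 * card {i \<in> {..<m}. \<omega> \<in> A 0 i}"
    and final: "\<And>\<omega>. \<omega> \<in> G n \<Longrightarrow> 3 * card {i \<in> {..<m}. \<omega> \<in> A n i} < m"
  shows False
proof -
  define c where "c j \<omega> = real (card {i \<in> {..<m}. \<omega> \<in> A j i})" for j \<omega>
  define \<mu> where "\<mu> j = (\<Sum>i<m. prob (A j i))" for j
  \<comment> \<open>A deviation of \<open>m / 12\<close> has probability at most
    \<open>144 * D / m < p\<close>, so the event \<open>G j\<close> of probability at least
    \<open>p\<close> contains a typical outcome.\<close>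
  have near: "\<exists>\<omega>\<in>G j. \<bar>c j \<omega> - \<mu> j\<bar> < real m / 12" if j: "j \<le> n" for j
  proof (rule ccontr)
    assume "\<not> ?thesis"
    then have sub: "G j \<subseteq> {\<omega> \<in> space M. real m / 12 \<le> \<bar>c j \<omega> - \<mu> j\<bar>}"
      using G(2)[OF j] by force
    have [measurable]: "c j \<in> borel_measurable M"
    proof -
      have "c j = (\<lambda>\<omega>. \<Sum>i<m. indicator (A j i) \<omega>)"
        by (simp add: fun_eq_iff c_def indicator_def sum.If_cases Int_def)
      then show ?thesis using A[OF j] by (auto intro!: borel_measurable_sum)
    qed
    have "{\<omega> \<in> space M. real m / 12 \<le> \<bar>c j \<omega> - \<mu> j\<bar>} \<in> events" by measurable
    then have "p \<le> prob {\<omega> \<in> space M. real m / 12 \<le> \<bar>c j \<omega> - \<mu> j\<bar>}"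
      by (rule order_trans[OF G(1)[OF j] finite_measure_mono[OF sub]])
    also have "\<dots> \<le> real (card {..<m}) * real D / (real m / 12)\<^sup>2"
      unfolding c_def \<mu>_def using A[OF j] D[OF j] \<open>0 < m\<close>
      by (intro prob_card_deviation_le) auto
    also have "\<dots> = 144 * real D / real m" using \<open>0 < m\<close> by (simp add: power2_eq_square)
    finally show False using large \<open>0 < m\<close> by (simp add: field_simps)
  qed
  have D12: "real D \<le> real m / 6"
  proof -
    have "p * real m \<le> 1 * real m" using \<open>p \<le> 1\<close> by (intro mult_right_mono) auto
    then show ?thesis using large by simp
  qed
  have s: "\<bar>\<mu> (Suc j) - \<mu> j\<bar> \<le> 7 * real m / 12 - 5 * real m / 12" if j: "j < n" for j
  proof -
    have "\<bar>\<mu> (Suc j) - \<mu> j\<bar> = \<bar>\<Sum>i<m. prob (A (Suc j) i) - prob (A j i)\<bar>"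
      by (simp add: \<mu>_def sum_subtractf)
    also have "\<dots> \<le> (\<Sum>i<m. \<bar>prob (A (Suc j) i) - prob (A j i)\<bar>)" by (rule sum_abs)
    \<comment> \<open>Unchanged events keep their probability, so the mean moves by at most the
      number of changed events.\<close>
    also have "\<dots> \<le> (\<Sum>i<m. of_bool (A (Suc j) i \<noteq> A j i))"
    proof (intro sum_mono)
      fix i
      have "\<bar>prob (A (Suc j) i) - prob (A j i)\<bar> \<le> 1"
        using prob_le_1[of "A (Suc j) i"] prob_le_1[of "A j i"]
          measure_nonneg[of M "A (Suc j) i"] measure_nonneg[of M "A j i"] by linarith
      then show "\<bar>prob (A (Suc j) i) - prob (A j i)\<bar> \<le> of_bool (A (Suc j) i \<noteq> A j i)" by auto
    qed
    also have "\<dots> = real (card {i \<in> {..<m}. A (Suc j) i \<noteq> A j i})"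
      by (simp add: of_bool_def sum.If_cases Int_def)
    also have "\<dots> \<le> real D" using step[OF j] by simp
    finally show ?thesis using D12 by simp
  qed
  obtain \<omega>0 where "\<omega>0 \<in> G 0" "\<bar>c 0 \<omega>0 - \<mu> 0\<bar> < real m / 12" using near[of 0] by auto
  then have "\<mu> 0 > 7 * real m / 12" using start[of \<omega>0] unfolding c_def by linarith
  moreover obtain \<omega>1 where "\<omega>1 \<in> G n" "\<bar>c n \<omega>1 - \<mu> n\<bar> < real m / 12" using near[of n] by auto
  then have "\<mu> n < 5 * real m / 12" using final[of \<omega>1] unfolding c_def by linarith
  ultimately obtain j where j: "j \<le> n" "5 * real m / 12 \<le> \<mu> j" "\<mu> j \<le> 7 * real m / 12"
    using exists_in_middle[of "7 * real m / 12" \<mu> n "5 * real m / 12"] s by auto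
  obtain \<omega> where "\<omega> \<in> G j" "\<bar>c j \<omega> - \<mu> j\<bar> < real m / 12" using near[OF j(1)] by auto
  then show False using gap[OF j(1), of \<omega>] j(2,3) unfolding c_def by linarith
qed

section \<open>Locality\<close>

text \<open>As the relation is reflexive, its \<open>t\<close>-th power describes the balls of
  radius \<open>t\<close>.\<close>

definition closed_adj :: "nat set set \<Rightarrow> (nat \<times> nat) set" where
  "closed_adj E = {(v, u). u = v \<or> {u, v} \<in> E}"

lemma closed_adj_pow_refl: "(v, v) \<in> closed_adj E ^^ t"
proof (induction t)
  case (Suc t)
  then show ?case by (auto simp: closed_adj_def)
qed simp

lemma closed_adj_pow_mono:
  assumes "s \<le> t" shows "closed_adj E ^^ s \<subseteq> closed_adj E ^^ t"
proof
  fix x assume "x \<in> closed_adj E ^^ s"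
  moreover obtain v u where x: "x = (v, u)" by fastforce
  moreover have "(u, u) \<in> closed_adj E ^^ (t - s)" by (rule closed_adj_pow_refl)
  ultimately have "x \<in> closed_adj E ^^ (s + (t - s))" unfolding relpow_add by blast
  then show "x \<in> closed_adj E ^^ t" using assms by simp
qed

text \<open>One more round brings only what a neighbour knew before, and the ball of radius
  \<open>t\<close> around a neighbour lies in the ball of radius \<open>Suc t\<close> around
  \<open>v\<close>.\<close>

lemma history_cong:
  assumes "\<And>u. (v, u) \<in> closed_adj E ^^ t \<Longrightarrow> neighbours E u = neighbours E' u \<and> \<omega> u = \<omega>' u"
  shows "history A V E \<omega> t v = history A V E' \<omega>' t v"
  using assms
proof (induction t arbitrary: v)
  case (Suc t)
  have nb: "neighbours E u = neighbours E' u" "\<omega> u = \<omega>' u" "history A V E \<omega> t u = history A V E' \<omega>' t u"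
    if u: "(v, u) \<in> closed_adj E" for u
  proof -
    have "(v, w) \<in> closed_adj E ^^ Suc t" if "(u, w) \<in> closed_adj E ^^ t" for w
      using u that by (rule relpow_Suc_I2)
    then show "neighbours E u = neighbours E' u" "\<omega> u = \<omega>' u" "history A V E \<omega> t u = history A V E' \<omega>' t u"
      using Suc closed_adj_pow_refl by blast+
  qed
  have v: "(v, v) \<in> closed_adj E" and uv: "\<And>u. u \<in> neighbours E v \<Longrightarrow> (v, u) \<in> closed_adj E"
    by (auto simp: closed_adj_def neighbours_def)
  have "(\<lambda>u. if u \<in> neighbours E v then Some (send_msg A (initial_knowledge V E \<omega> u) (history A V E \<omega> t u) v) else None)
      = (\<lambda>u. if u \<in> neighbours E' v then Some (send_msg A (initial_knowledge V E' \<omega>' u) (history A V E' \<omega>' t u) v) else None)"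
    using nb[OF uv] nb(1)[OF v] by (intro ext if_cong) (simp_all add: initial_knowledge_def)
  then show ?case using nb(3)[OF v] by simp
qed simp

text \<open>Used in two ways: with one graph and different coins for independence, and with the same
  coins and two graphs for stability when a pendant edge changes.\<close>

lemma computed_set_cong:
  assumes "\<And>u. (v, u) \<in> closed_adj E ^^ T \<Longrightarrow> neighbours E u = neighbours E' u \<and> \<omega> u = \<omega>' u"
  shows "v \<in> computed_set A T V E \<omega> \<longleftrightarrow> v \<in> computed_set A T V E' \<omega>'"
  using history_cong[OF assms, where A = A and V = V] assms[of v] closed_adj_pow_refl[where v = v and E = E and t = T]
  by (simp add: computed_set_def initial_knowledge_def)

lemma closed_adj_pow_in:
  assumes "(v, u) \<in> closed_adj E ^^ t" "v \<in> V" "\<And>e. e \<in> E \<Longrightarrow> e \<subseteq> V"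
  shows "u \<in> V"
  using assms(1)
proof (induction t arbitrary: u)
  case (Suc t)
  then show ?case using assms(3) by (auto simp: closed_adj_def)
qed (use assms in simp)

lemma card_UN_le_mult:
  assumes "finite A" "\<And>x. x \<in> A \<Longrightarrow> card (F x) \<le> k"
  shows "card (\<Union>x\<in>A. F x) \<le> card A * k"
proof -
  have "card (\<Union>x\<in>A. F x) \<le> (\<Sum>x\<in>A. card (F x))" by (rule card_UN_le[OF assms(1)])
  also have "\<dots> \<le> (\<Sum>x\<in>A. k)" using assms(2) by (rule sum_mono)
  finally show ?thesis by simp
qed

lemma card_relpow_image_le:
  fixes r :: "('a \<times> 'a) set"
  assumes "\<And>x. finite (r `` {x})" "\<And>x. card (r `` {x}) \<le> d"
  shows "finite ((r ^^ k) `` {x}) \<and> card ((r ^^ k) `` {x}) \<le> d ^ k"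
proof (induction k)
  case (Suc k)
  have eq: "(r ^^ Suc k) `` {x} = (\<Union>y\<in>(r ^^ k) `` {x}. r `` {y})" by auto
  have "card ((r ^^ Suc k) `` {x}) \<le> card ((r ^^ k) `` {x}) * d"
    unfolding eq by (rule card_UN_le_mult) (use Suc assms in auto)
  also have "\<dots> \<le> d ^ k * d" using Suc by (intro mult_right_mono) auto
  finally show ?case unfolding eq using Suc assms by (auto simp: mult.commute)
qed simp

lemma vertex_coverD: "vertex_cover V E C \<Longrightarrow> {u, v} \<in> E \<Longrightarrow> u \<in> C \<or> v \<in> C"
  unfolding vertex_cover_def by auto

lemma sym_relpow: "sym r \<Longrightarrow> sym (r ^^ k)"
proof (induction k)
  case 0
  show ?case by (auto simp: sym_def)
next
  case (Suc k)
  have "(y, x) \<in> r ^^ Suc k" if "(x, y) \<in> r ^^ Suc k" for x y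
  proof -
    from that obtain z where "(x, z) \<in> r ^^ k" "(z, y) \<in> r" by auto
    then have "(y, z) \<in> r" "(z, x) \<in> r ^^ k" using Suc by (auto dest: symD)
    then show ?thesis by (rule relpow_Suc_I2)
  qed
  then show ?case by (rule symI)
qed

lemma prob_space_coin_flips: "prob_space coin_flips"
  unfolding coin_flips_def by (intro prob_space_PiM measure_pmf.prob_space_axioms)

section \<open>The chorded path\<close>

definition near :: "nat \<Rightarrow> nat set" where
  "near b = {b - 1, b, b + 1}"

lemma near_sym: "c \<in> near b \<Longrightarrow> b \<in> near c"
  by (auto simp: near_def)

lemma finite_near: "finite (near b)" and card_near_le: "card (near b) \<le> 3"
  by (auto simp: near_def card_insert_if)

text \<open>The path takes \<open>12 * g * m\<close> identifiers and the pendant nodes take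
  \<open>m\<close>; further numbers below \<open>n\<close> become isolated nodes, which lets
  \<open>n\<close> be arbitrary.\<close>

locale chorded_path =
  fixes g m n :: nat and \<pi> :: "nat \<Rightarrow> nat"
  assumes g: "0 < g" and m: "0 < m" and \<pi>: "\<pi> permutes {..<m}" and n: "12 * g * m + m \<le> n"
begin

definition W :: nat where "W = 12 * g"
definition N :: nat where "N = W * m"

text \<open>As \<open>W\<close> is even, a chord joins an odd node to an even one. The offsets
  \<open>0\<close>, \<open>6 * g\<close>, \<open>6 * g + 1\<close> and \<open>6 * g + 3\<close> are
  distinct, so a path node gets at most one edge besides those of the path.\<close>

definition E :: "nat set \<Rightarrow> nat set \<Rightarrow> nat set set" where
  "E R B = {{x, Suc x} | x. Suc x < N} \<union> {{W * i + 6 * g + 1, W * \<pi> i} | i. i < m}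
     \<union> {{N + i, W * i + 6 * g} | i. i \<in> R} \<union> {{N + i, W * i + 6 * g + 3} | i. i \<in> B}"

text \<open>A pendant node is placed at the middle of its block, at distance at most 2 from its neighbour.\<close>

definition pos :: "nat \<Rightarrow> nat" where
  "pos x = (if x < N then x else W * (x - N) + 6 * g + 1)"

definition blk :: "nat \<Rightarrow> nat" where
  "blk x = pos x div W"

definition chord :: "nat \<Rightarrow> nat \<Rightarrow> bool" where
  "chord p q \<longleftrightarrow> (\<exists>i<m. p = W * i + 6 * g + 1 \<and> q = W * \<pi> i \<or> q = W * i + 6 * g + 1 \<and> p = W * \<pi> i)"

text \<open>An upper bound for the moves between blocks in a walk of length \<open>g\<close>: a
  shift by at most one block, at most one chord in either direction, and another such shift.\<close>

definition blk_rel :: "(nat \<times> nat) set" where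
  "blk_rel = {(b, c). \<exists>b' c'. b' \<in> near b \<and> c \<in> near c' \<and> (c' = b' \<or> c' = \<pi> b' \<or> b' = \<pi> c')}"

lemma W_pos: "0 < W" using g by (simp add: W_def)

lemma pi_less: "i < m \<Longrightarrow> \<pi> i < m"
  using permutes_in_image[OF \<pi>] by simp

lemma offset_less_N:
  assumes "i < m" "o' < W" shows "W * i + o' < N"
proof -
  have "W * i + o' < W * Suc i" using assms by simp
  also have "\<dots> \<le> N" unfolding N_def using assms by (intro mult_le_mono2) simp
  finally show ?thesis .
qed

lemma offset_eqD:
  assumes "W * i + a = W * j + b" "a < W" "b < W"
  shows "i = j \<and> a = b"
proof -
  have "(W * i + a) div W = i" "(W * j + b) div W = j" using assms(2,3) W_pos by simp_all
  then have "i = j" using assms(1) by simp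
  then show ?thesis using assms(1) by simp
qed

lemma N_n: "N + m \<le> n" using n by (simp add: N_def W_def)

section \<open>The instances as bipartite graphs of maximum degree 3\<close>

lemma edge_in_V:
  assumes "R \<subseteq> {..<m}" "B \<subseteq> {..<m}" "e \<in> E R B"
  shows "\<exists>u v. e = {u, v} \<and> u < n \<and> v < n \<and> u \<noteq> v"
proof -
  have o: "6 * g + 1 < W" "6 * g < W" "6 * g + 3 < W" "0 < W" using g by (auto simp: W_def)
  from assms(3) consider x where "e = {x, Suc x}" "Suc x < N" | i where "i < m" "e = {W * i + 6 * g + 1, W * \<pi> i}"
    | i where "i < m" "e = {N + i, W * i + 6 * g}" | i where "i < m" "e = {N + i, W * i + 6 * g + 3}"
    using assms(1,2) by (auto simp: E_def)
  then show ?thesis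
  proof cases
    case 1
    then show ?thesis using N_n by (intro exI[of _ x] exI[of _ "Suc x"]) auto
  next
    case 2
    have "W * i + (6 * g + 1) \<noteq> W * \<pi> i + 0" using offset_eqD[of i "6 * g + 1" "\<pi> i" 0] o by auto
    then show ?thesis using offset_less_N[OF 2(1) o(1)] offset_less_N[OF pi_less[OF 2(1)] o(4)] N_n 2(2)
      by (intro exI[of _ "W * i + 6 * g + 1"] exI[of _ "W * \<pi> i"]) auto
  next
    case 3
    then show ?thesis using offset_less_N[OF 3(1) o(2)] N_n
      by (intro exI[of _ "N + i"] exI[of _ "W * i + 6 * g"]) auto
  next
    case 4
    then show ?thesis using offset_less_N[OF 4(1) o(3)] N_n
      by (intro exI[of _ "N + i"] exI[of _ "W * i + 6 * g + 3"]) auto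
  qed
qed

lemma simple_graph_E:
  assumes "R \<subseteq> {..<m}" "B \<subseteq> {..<m}"
  shows "simple_graph {..<n} (E R B)"
  unfolding simple_graph_def
proof (intro conjI subsetI)
  fix e assume "e \<in> E R B"
  from edge_in_V[OF assms this] show "e \<in> {{u, v} | u v. u \<in> {..<n} \<and> v \<in> {..<n} \<and> u \<noteq> v}"
    by simp
qed simp

lemma even_W: "even (W * i)" by (simp add: W_def)

lemma bipartite_graph_E:
  assumes "R \<subseteq> {..<m}" "B \<subseteq> {..<m}" "R = {} \<or> B = {}"
  shows "bipartite_graph {..<n} (E R B)"
proof -
  \<comment> \<open>Path nodes are coloured by parity. The pendant nodes all go to one side,
    opposite to the even nodes if \<open>B = {}\<close> and opposite to the odd nodes
    otherwise.\<close>
  define X where "X = {x. x < n \<and> (if x < N then even x else B \<noteq> {})}"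
  define Y where "Y = {..<n} - X"
  have o: "6 * g + 1 < W" "6 * g < W" "6 * g + 3 < W" "0 < W" using g by (auto simp: W_def)
  have *: "\<exists>x\<in>X. \<exists>y\<in>Y. e = {x, y}" if e: "e \<in> E R B" for e
  proof -
    have two: "?thesis" if "e = {u, v}" "u \<in> X" "v \<in> Y" for u v using that by blast
    from e consider x where "e = {x, Suc x}" "Suc x < N" | i where "i < m" "e = {W * i + 6 * g + 1, W * \<pi> i}"
      | i where "i < m" "i \<in> R" "e = {N + i, W * i + 6 * g}" | i where "i < m" "i \<in> B" "e = {N + i, W * i + 6 * g + 3}"
      using assms(1,2) by (auto simp: E_def)
    then show ?thesis
    proof cases
      case 1
      show ?thesis
      proof (cases "even x")
        case True
        then show ?thesis using 1 N_n by (intro two[of x "Suc x"]) (auto simp: X_def Y_def)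
      next
        case False
        then show ?thesis using 1 N_n by (intro two[of "Suc x" x]) (auto simp: X_def Y_def)
      qed
    next
      case 2
      show ?thesis using offset_less_N[OF 2(1) o(1)] offset_less_N[OF pi_less[OF 2(1)] o(4)] N_n 2(2) even_W[of i] even_W[of "\<pi> i"]
        by (intro two[of "W * \<pi> i" "W * i + 6 * g + 1"]) (auto simp: X_def Y_def)
    next
      case 3
      then have "B = {}" using assms(3) by auto
      then show ?thesis using offset_less_N[OF 3(1) o(2)] N_n 3 even_W[of i]
        by (intro two[of "W * i + 6 * g" "N + i"]) (auto simp: X_def Y_def)
    next
      case 4
      then show ?thesis using offset_less_N[OF 4(1) o(3)] N_n 4 even_W[of i]
        by (intro two[of "N + i" "W * i + 6 * g + 3"]) (auto simp: X_def Y_def)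
    qed
  qed
  have "X \<union> Y = {..<n}" "X \<inter> Y = {}" by (auto simp: X_def Y_def)
  moreover have "\<forall>e\<in>E R B. \<exists>x\<in>X. \<exists>y\<in>Y. e = {x, y}" using * by (rule ballI)
  ultimately have "\<exists>X Y. X \<union> Y = {..<n} \<and> X \<inter> Y = {} \<and> (\<forall>e\<in>E R B. \<exists>x\<in>X. \<exists>y\<in>Y. e = {x, y})"
    by (intro exI conjI)
  then show ?thesis unfolding bipartite_graph_def using simple_graph_E[OF assms(1,2)] by (intro conjI)
qed

lemma edge_cases:
  assumes "{u, v} \<in> E R B"
  obtains "v = Suc u" "v < N" | "u = Suc v" "u < N"
    | i where "i < m" "u = W * i + 6 * g + 1" "v = W * \<pi> i"
    | i where "i < m" "v = W * i + 6 * g + 1" "u = W * \<pi> i"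
    | i where "i \<in> R" "u = N + i" "v = W * i + 6 * g"
    | i where "i \<in> R" "v = N + i" "u = W * i + 6 * g"
    | i where "i \<in> B" "u = N + i" "v = W * i + 6 * g + 3"
    | i where "i \<in> B" "v = N + i" "u = W * i + 6 * g + 3"
  using assms unfolding E_def by (auto simp: doubleton_eq_iff)

lemma div_mod_offset: "a < W \<Longrightarrow> (W * i + a) div W = i" "a < W \<Longrightarrow> (W * i + a) mod W = a"
  using W_pos by simp_all

lemma offsets_less: "6 * g + 1 < W" "6 * g < W" "6 * g + 3 < W" "6 * g + 2 < W"
  using g by (auto simp: W_def)

lemma card_neighbours_le:
  assumes RB: "R \<subseteq> {..<m}" "B \<subseteq> {..<m}" "R = {} \<or> B = {}"
  shows "finite (neighbours (E R B) v)" "card (neighbours (E R B) v) \<le> 3"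
proof -
  \<comment> \<open>The one candidate for a neighbour besides \<open>v - 1\<close> and
    \<open>v + 1\<close>: the attachment point of a pendant node, the other end of a chord, or the
    pendant node of the block.\<close>
  define f where "f v = (if N \<le> v then W * (v - N) + 6 * g + (if R = {} then 3 else 0)
     else if v mod W = 6 * g + 1 then W * \<pi> (v div W)
     else if v mod W = 0 then W * inv \<pi> (v div W) + 6 * g + 1 else N + v div W)" for v
  have f1: "f (W * i + 6 * g + 1) = W * \<pi> i" if "i < m" for i
    using offset_less_N[OF that offsets_less(1)] div_mod_offset[OF offsets_less(1), of i]
    by (simp add: f_def add.assoc del: add_2_eq_Suc' add_Suc_right One_nat_def)
  have f2: "f (W * \<pi> i) = W * i + 6 * g + 1" if "i < m" for i
    using offset_less_N[OF pi_less[OF that] W_pos] div_mod_offset[OF W_pos, of "\<pi> i"] permutes_inverses(2)[OF \<pi>]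
    by (simp add: f_def)
  have f3: "f (W * i + 6 * g) = N + i" if "i < m" for i
    using offset_less_N[OF that offsets_less(2)] div_mod_offset[OF offsets_less(2), of i] g
    by (simp add: f_def)
  have f4: "f (W * i + 6 * g + 3) = N + i" if "i < m" for i
    using offset_less_N[OF that offsets_less(3)] div_mod_offset[OF offsets_less(3), of i] g
    by (simp add: f_def add.assoc del: add_2_eq_Suc' add_Suc_right One_nat_def)
  have "neighbours (E R B) v \<subseteq> {v - 1, v + 1, f v}"
  proof
    fix u assume "u \<in> neighbours (E R B) v"
    then have "{u, v} \<in> E R B" by (simp add: neighbours_def)
    then show "u \<in> {v - 1, v + 1, f v}"
    proof (cases rule: edge_cases)
      case (3 i) then show ?thesis using f2 by simp
    next
      case (4 i) then show ?thesis using f1 by simp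
    next
      case (5 i) then have "i < m" using RB by auto
      then show ?thesis using f3 5 by simp
    next
      case (6 i) then show ?thesis by (auto simp: f_def)
    next
      case (7 i) then have "i < m" using RB by auto
      then show ?thesis using f4 7 by simp
    next
      case (8 i) then have "R = {}" using RB(3) by auto
      then show ?thesis using 8 by (auto simp: f_def)
    qed auto
  qed
  moreover have "card {v - 1, v + 1, f v} \<le> 3" by (simp add: card_insert_if)
  ultimately show "finite (neighbours (E R B) v)" "card (neighbours (E R B) v) \<le> 3"
    using card_mono[of "{v - 1, v + 1, f v}" "neighbours (E R B) v"] finite_subset[of _ "{v - 1, v + 1, f v}"] by auto
qed

lemma max_degree_eq:
  assumes RB: "R \<subseteq> {..<m}" "B \<subseteq> {..<m}" "R = {} \<or> B = {}"
  shows "max_degree {..<n} (E R B) = 3"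
  unfolding max_degree_def
proof (rule Max_eqI)
  show "finite ((\<lambda>v. card (neighbours (E R B) v)) ` {..<n})" by simp
  show "y \<le> 3" if "y \<in> (\<lambda>v. card (neighbours (E R B) v)) ` {..<n}" for y
    using that card_neighbours_le[OF RB] by auto
  have less: "6 * g + 2 < N" using offset_less_N[OF m offsets_less(4)] by simp
  have "{6 * g, 6 * g + 2, W * \<pi> 0} \<subseteq> neighbours (E R B) (6 * g + 1)"
  proof -
    have "{6 * g, 6 * g + 1} \<in> E R B" "{6 * g + 1, 6 * g + 2} \<in> E R B"
      using less unfolding E_def by auto
    moreover have "{W * 0 + 6 * g + 1, W * \<pi> 0} \<in> E R B" using m unfolding E_def by blast
    ultimately show ?thesis by (auto simp: neighbours_def insert_commute)
  qed
  then have "card {6 * g, 6 * g + 2, W * \<pi> 0} \<le> card (neighbours (E R B) (6 * g + 1))"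
    by (rule card_mono[OF card_neighbours_le(1)[OF RB]])
  moreover have "W * \<pi> 0 \<noteq> 6 * g" "W * \<pi> 0 \<noteq> 6 * g + 2"
    using offset_eqD[of "\<pi> 0" 0 0 "6 * g"] offset_eqD[of "\<pi> 0" 0 0 "6 * g + 2"] offsets_less g
    by (auto simp: W_pos)
  then have "card {6 * g, 6 * g + 2, W * \<pi> 0} = 3" by simp
  ultimately have "card (neighbours (E R B) (6 * g + 1)) = 3"
    using card_neighbours_le(2)[OF RB, of "6 * g + 1"] by linarith
  moreover have "6 * g + 1 < n" using less N_n by simp
  ultimately show "3 \<in> (\<lambda>v. card (neighbours (E R B) v)) ` {..<n}"
    by (intro image_eqI[where x = "6 * g + 1"]) auto
qed

text \<open>Without blue pendant edges the even path nodes form a cover; otherwise there are no red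
  ones and the odd path nodes do.\<close>

lemma min_vertex_cover_size_le:
  assumes RB: "R \<subseteq> {..<m}" "B \<subseteq> {..<m}" "R = {} \<or> B = {}"
  shows "min_vertex_cover_size {..<n} (E R B) \<le> 6 * g * m"
proof -
  have N: "N = 2 * (6 * g * m)" by (simp add: N_def W_def)
  obtain C where C: "vertex_cover {..<n} (E R B) C" "card C = 6 * g * m"
  proof (cases "B = {}")
    case True
    have "vertex_cover {..<n} (E R B) ((\<lambda>p. 2 * p) ` {..<6 * g * m})"
      unfolding vertex_cover_def
    proof (intro conjI ballI)
      show "(\<lambda>p. 2 * p) ` {..<6 * g * m} \<subseteq> {..<n}" using N_n N by auto
      have ev: "x \<in> (\<lambda>p. 2 * p) ` {..<6 * g * m}" if "x < N" "even x" for x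
        using that N by (auto elim!: evenE)
      fix e assume e: "e \<in> E R B"
      then consider x where "e = {x, Suc x}" "Suc x < N" | i where "i < m" "W * \<pi> i \<in> e"
        | i where "i < m" "W * i + 6 * g \<in> e"
        using RB(1) True unfolding E_def by auto
      then show "e \<inter> (\<lambda>p. 2 * p) ` {..<6 * g * m} \<noteq> {}"
      proof cases
        case 1 then show ?thesis using ev[of x] ev[of "Suc x"] by (cases "even x") auto
      next
        case 2 then show ?thesis using ev[of "W * \<pi> i"] offset_less_N[OF pi_less[OF 2(1)] W_pos] even_W[of "\<pi> i"] by auto
      next
        case 3 then show ?thesis using ev[of "W * i + 6 * g"] offset_less_N[OF 3(1) offsets_less(2)] even_W[of i] by auto
      qed
    qed
    moreover have "card ((\<lambda>p. 2 * p) ` {..<6 * g * m}) = 6 * g * m"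
      by (subst card_image) (auto intro: inj_onI)
    ultimately show ?thesis by (rule that)
  next
    case False
    have "vertex_cover {..<n} (E R B) ((\<lambda>p. 2 * p + 1) ` {..<6 * g * m})"
      unfolding vertex_cover_def
    proof (intro conjI ballI)
      show "(\<lambda>p. 2 * p + 1) ` {..<6 * g * m} \<subseteq> {..<n}" using N_n N by auto
      have od: "x \<in> (\<lambda>p. 2 * p + 1) ` {..<6 * g * m}" if "x < N" "odd x" for x
        using that N by (auto elim!: oddE)
      fix e assume e: "e \<in> E R B"
      then consider x where "e = {x, Suc x}" "Suc x < N" | i where "i < m" "W * i + 6 * g + 1 \<in> e"
        | i where "i < m" "W * i + 6 * g + 3 \<in> e"
        using RB False unfolding E_def by auto
      then show "e \<inter> (\<lambda>p. 2 * p + 1) ` {..<6 * g * m} \<noteq> {}"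
      proof cases
        case 1 then show ?thesis using od[of x] od[of "Suc x"] by (cases "even x") auto
      next
        case 2 then show ?thesis using od[of "W * i + 6 * g + 1"] offset_less_N[OF 2(1) offsets_less(1)] even_W[of i] by auto
      next
        case 3 then show ?thesis using od[of "W * i + 6 * g + 3"] offset_less_N[OF 3(1) offsets_less(3)] even_W[of i] by auto
      qed
    qed
    moreover have "card ((\<lambda>p. 2 * p + 1) ` {..<6 * g * m}) = 6 * g * m"
      by (subst card_image) (auto intro: inj_onI)
    ultimately show ?thesis by (rule that)
  qed
  have "finite {C. vertex_cover {..<n} (E R B) C}"
    by (rule finite_subset[of _ "Pow {..<n}"]) (auto simp: vertex_cover_def)
  then show ?thesis unfolding min_vertex_cover_size_def using C
    by (intro Min_le) (auto intro!: image_eqI[where x = C])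
qed

section \<open>The excess of a cover over the perfect matching of the path\<close>

definition doubled :: "nat set \<Rightarrow> nat set" where
  "doubled C = {p. p < 6 * g * m \<and> 2 * p \<in> C \<and> 2 * p + 1 \<in> C}"

definition pendants :: "nat set \<Rightarrow> nat set" where
  "pendants C = {i. i < m \<and> N + i \<in> C}"

text \<open>A block is classified by its middle node, which is odd; if that node is left out, its
  even path neighbours are forced into the cover.\<close>

definition even_blocks :: "nat set \<Rightarrow> nat set" where
  "even_blocks C = {i. i < m \<and> W * i + 6 * g + 1 \<notin> C}"

lemma N_eq: "N = 2 * (6 * g * m)" by (simp add: N_def W_def)

lemma finite_doubled: "finite (doubled C)" by (simp add: doubled_def)
lemma finite_pendants: "finite (pendants C)" by (simp add: pendants_def)

lemma path_edge: "Suc x < N \<Longrightarrow> vertex_cover V (E R B) C \<Longrightarrow> x \<in> C \<or> Suc x \<in> C"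
  by (rule vertex_coverD) (auto simp: E_def)

text \<open>The edges from \<open>2 * p\<close> to \<open>2 * p + 1\<close> are a perfect matching
  of the path. Each needs one node of \<open>C\<close>, a doubled one takes a second, and pendant
  nodes lie off the path.\<close>

lemma card_cover_ge:
  assumes C: "vertex_cover {..<n} (E R B) C"
  shows "6 * g * m + (card (doubled C) + card (pendants C)) \<le> card C"
proof -
  let ?H = "6 * g * m"
  have finC: "finite C" using C finite_subset by (auto simp: vertex_cover_def)
  define P where "P = {p. p < ?H \<and> 2 * p \<in> C}"
  define Q where "Q = {p. p < ?H \<and> 2 * p + 1 \<in> C}"
  have fin: "finite P" "finite Q" by (auto simp: P_def Q_def)
  have "p \<in> P \<union> Q" if "p < ?H" for p
    using path_edge[of "2 * p" "{..<n}" R B C] C that N_eq by (auto simp: P_def Q_def)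
  then have "P \<union> Q = {..<?H}" by (auto simp: P_def Q_def)
  moreover have "P \<inter> Q = doubled C" by (auto simp: P_def Q_def doubled_def)
  ultimately have PQ: "card P + card Q = ?H + card (doubled C)"
    using card_Un_Int[OF fin] by simp
  have "card ((\<lambda>p. 2 * p) ` P \<union> (\<lambda>p. 2 * p + 1) ` Q \<union> (\<lambda>i. N + i) ` pendants C)
      = card ((\<lambda>p. 2 * p) ` P \<union> (\<lambda>p. 2 * p + 1) ` Q) + card ((\<lambda>i. N + i) ` pendants C)"
    by (rule card_Un_disjoint) (use fin finite_pendants N_eq in \<open>auto simp: P_def Q_def\<close>)
  also have "card ((\<lambda>p. 2 * p) ` P \<union> (\<lambda>p. 2 * p + 1) ` Q) = card ((\<lambda>p. 2 * p) ` P) + card ((\<lambda>p. 2 * p + 1) ` Q)"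
    by (rule card_Un_disjoint) (use fin in \<open>auto, presburger\<close>)
  also have "card ((\<lambda>p. 2 * p) ` P) = card P" by (rule card_image) (auto intro: inj_onI)
  also have "card ((\<lambda>p. 2 * p + 1) ` Q) = card Q" by (rule card_image) (auto intro: inj_onI)
  also have "card ((\<lambda>i. N + i) ` pendants C) = card (pendants C)" by (rule card_image) (auto intro: inj_onI)
  finally have "card P + card Q + card (pendants C)
      = card ((\<lambda>p. 2 * p) ` P \<union> (\<lambda>p. 2 * p + 1) ` Q \<union> (\<lambda>i. N + i) ` pendants C)" by simp
  also have "\<dots> \<le> card C" by (rule card_mono[OF finC]) (auto simp: P_def Q_def pendants_def)
  finally show ?thesis using PQ by simp
qed

text \<open>An omitted odd node forces the even node of the next matching edge. This goes on until
  the first edge whose odd node is chosen, and that edge is then doubled.\<close>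

lemma doubled_between:
  assumes C: "vertex_cover V (E R B) C" and "p \<le> q" "q < 6 * g * m" "2 * p + 1 \<notin> C" "2 * q + 1 \<in> C"
  shows "\<exists>r\<in>doubled C. p < r \<and> r \<le> q"
  using assms(2-5)
proof (induction q rule: dec_induct)
  case (step q)
  show ?case
  proof (cases "2 * q + 1 \<in> C")
    case True
    then obtain r where "r \<in> doubled C" "p < r" "r \<le> q" using step by auto
    then show ?thesis by (intro bexI[of _ r]) auto
  next
    case False
    have "Suc (2 * q + 1) < N" using step N_eq by simp
    then have "Suc (2 * q + 1) \<in> C" using path_edge C False by blast
    then have "Suc q \<in> doubled C" using step by (simp add: doubled_def)
    then show ?thesis using step(1) by (intro bexI[of _ "Suc q"]) auto
  qed
qed simp

lemma half_offset: "2 * (6 * g * i + 3 * g) + 1 = W * i + 6 * g + 1" "2 * (6 * g * i) = W * i"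
  "2 * (6 * g * i + 3 * g) = W * i + 6 * g" "2 * (6 * g * i + 3 * g + 1) = W * i + 6 * g + 2"
  "2 * (6 * g * i + 3 * g + 1) + 1 = W * i + 6 * g + 3"
  by (simp_all add: W_def)

lemma half_less: "i < m \<Longrightarrow> a < 6 * g \<Longrightarrow> 6 * g * i + a < 6 * g * m"
  using offset_less_N[of i "2 * a"] N_eq by (simp add: W_def)

lemma half_div: "6 * g * i \<le> p \<Longrightarrow> p < 6 * g * i + 6 * g \<Longrightarrow> p div (6 * g) = i"
  using g by (intro div_nat_eqI) (auto simp: algebra_simps)

text \<open>Each exit forces a doubled edge between the middles of two consecutive blocks, and these
  stretches are disjoint.\<close>

lemma path_cut_even_blocks_le:
  assumes C: "vertex_cover V (E R B) C"
  shows "card (path_cut m (even_blocks C)) \<le> card (doubled C)"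
proof -
  \<comment> \<open>The shift by \<open>3 * g + 1\<close> moves the stretch after the middle of
    block \<open>i\<close> to a range starting at \<open>6 * g * i\<close>, so the division recovers
    \<open>i\<close>.\<close>
  have "path_cut m (even_blocks C) \<subseteq> (\<lambda>p. (p - (3 * g + 1)) div (6 * g)) ` doubled C"
  proof
    fix i assume i: "i \<in> path_cut m (even_blocks C)"
    then have "Suc i < m" "W * i + 6 * g + 1 \<notin> C" "W * Suc i + 6 * g + 1 \<in> C"
      by (auto simp: path_cut_def even_blocks_def)
    moreover have "6 * g * i + 3 * g \<le> 6 * g * Suc i + 3 * g" by simp
    moreover have "6 * g * Suc i + 3 * g < 6 * g * m" using half_less[OF \<open>Suc i < m\<close>, of "3 * g"] g by simp
    ultimately obtain r where r: "r \<in> doubled C" "6 * g * i + 3 * g < r" "r \<le> 6 * g * Suc i + 3 * g"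
      using doubled_between[OF C, of "6 * g * i + 3 * g" "6 * g * Suc i + 3 * g", unfolded half_offset(1)] by blast
    then have "(r - (3 * g + 1)) div (6 * g) = i" by (intro half_div) auto
    then show "i \<in> (\<lambda>p. (p - (3 * g + 1)) div (6 * g)) ` doubled C" using r(1) by blast
  qed
  then show ?thesis by (rule surj_card_le[OF finite_doubled])
qed

text \<open>If the middle of block \<open>i\<close> is left out, its chord forces the first node of
  block \<open>\<pi> i\<close>, an even one. If the middle of that block is chosen, the switch to
  odd nodes happens in between, at a doubled edge of the target block.\<close>

lemma permutation_cut_even_blocks_le:
  assumes C: "vertex_cover V (E R B) C"
  shows "card (\<pi> ` even_blocks C - even_blocks C) \<le> card (doubled C)"
proof -
  have "\<pi> ` even_blocks C - even_blocks C \<subseteq> (\<lambda>p. p div (6 * g)) ` doubled C"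
  proof
    fix j assume "j \<in> \<pi> ` even_blocks C - even_blocks C"
    then obtain i where i: "i < m" "j = \<pi> i" "W * i + 6 * g + 1 \<notin> C" and j: "j \<notin> even_blocks C"
      by (auto simp: even_blocks_def)
    have jm: "j < m" using i pi_less by simp
    have "{W * i + 6 * g + 1, W * j} \<in> E R B" using i unfolding E_def by blast
    then have "W * j \<in> C" using vertex_coverD[OF C] i(3) by blast
    moreover have jC: "W * j + 6 * g + 1 \<in> C" using j jm by (simp add: even_blocks_def)
    have H: "6 * g * j + 3 * g < 6 * g * m" "6 * g * j < 6 * g * m"
      using half_less[OF jm, of "3 * g"] g jm by auto
    obtain r where r: "r \<in> doubled C" "6 * g * j \<le> r" "r \<le> 6 * g * j + 3 * g"
    \<comment> \<open>Either the first matching edge of block \<open>j\<close> is itself doubled, or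
      its odd node is left out and \<open>doubled_between\<close> applies up to the middle.\<close>
    proof (cases "2 * (6 * g * j) + 1 \<in> C")
      case True
      then have "6 * g * j \<in> doubled C" using \<open>W * j \<in> C\<close> H
        unfolding doubled_def mem_Collect_eq half_offset by blast
      then show ?thesis by (rule that) auto
    next
      case False
      then obtain r where "r \<in> doubled C" "6 * g * j < r" "r \<le> 6 * g * j + 3 * g"
        using doubled_between[OF C, of "6 * g * j" "6 * g * j + 3 * g", unfolded half_offset(1)] H jC
        by (meson le_add1)
      then show ?thesis by (intro that[of r]) auto
    qed
    then have "r div (6 * g) = j" using g by (intro half_div) auto
    then show "j \<in> (\<lambda>p. p div (6 * g)) ` doubled C" using r(1) by blast
  qed
  then show ?thesis by (rule surj_card_le[OF finite_doubled])
qed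

lemma card_le_doubled_pendants:
  assumes "X \<subseteq> (\<lambda>p. p div (6 * g)) ` doubled C \<union> pendants C"
  shows "card X \<le> card (doubled C) + card (pendants C)"
proof -
  have "card X \<le> card ((\<lambda>p. p div (6 * g)) ` doubled C \<union> pendants C)"
    using assms by (rule card_mono[rotated]) (simp add: finite_doubled finite_pendants)
  also have "\<dots> \<le> card ((\<lambda>p. p div (6 * g)) ` doubled C) + card (pendants C)" by (rule card_Un_le)
  also have "\<dots> \<le> card (doubled C) + card (pendants C)" using card_image_le[OF finite_doubled] by simp
  finally show ?thesis .
qed

text \<open>If the pendant node is left out, the node at offset \<open>6 * g\<close> is forced and
  forms a doubled edge with the chosen middle.\<close>

lemma red_cut_le:
  assumes C: "vertex_cover V (E R B) C" and R: "R \<subseteq> {..<m}"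
  shows "card (R - even_blocks C) \<le> card (doubled C) + card (pendants C)"
proof (rule card_le_doubled_pendants, rule subsetI)
  fix i assume i: "i \<in> R - even_blocks C"
  have im: "i < m" using i R by auto
  have "{N + i, W * i + 6 * g} \<in> E R B" using i unfolding E_def by blast
  then have *: "N + i \<in> C \<or> W * i + 6 * g \<in> C" by (rule vertex_coverD[OF C])
  have iC: "W * i + 6 * g + 1 \<in> C" using i im by (auto simp: even_blocks_def)
  show "i \<in> (\<lambda>p. p div (6 * g)) ` doubled C \<union> pendants C"
  proof (cases "N + i \<in> C")
    case False
    then have "6 * g * i + 3 * g \<in> doubled C"
      unfolding doubled_def mem_Collect_eq half_offset using * iC half_less[OF im, of "3 * g"] g by auto
    moreover have "(6 * g * i + 3 * g) div (6 * g) = i" using g by (intro half_div) auto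
    ultimately show ?thesis by force
  qed (use im in \<open>simp add: pendants_def\<close>)
qed

text \<open>The omitted middle forces its successor, and an omitted pendant node forces the node at
  offset \<open>6 * g + 3\<close>; these two form a matching edge.\<close>

lemma blue_cut_le:
  assumes C: "vertex_cover V (E R B) C" and B: "B \<subseteq> {..<m}"
  shows "card (B \<inter> even_blocks C) \<le> card (doubled C) + card (pendants C)"
proof (rule card_le_doubled_pendants, rule subsetI)
  fix i assume i: "i \<in> B \<inter> even_blocks C"
  have im: "i < m" using i B by auto
  have "{N + i, W * i + 6 * g + 3} \<in> E R B" using i unfolding E_def by blast
  then have *: "N + i \<in> C \<or> W * i + 6 * g + 3 \<in> C" by (rule vertex_coverD[OF C])
  have iC: "W * i + 6 * g + 1 \<notin> C" using i im by (auto simp: even_blocks_def)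
  have "Suc (W * i + 6 * g + 1) < N" using offset_less_N[OF im offsets_less(4)] by simp
  then have iC2: "W * i + 6 * g + 2 \<in> C" using path_edge[OF _ C] iC by force
  show "i \<in> (\<lambda>p. p div (6 * g)) ` doubled C \<union> pendants C"
  proof (cases "N + i \<in> C")
    case False
    then have "W * i + 6 * g + 2 + 1 \<in> C" using * by (simp add: eval_nat_numeral)
    moreover have "6 * g * i + 3 * g + 1 < 6 * g * m"
      using half_less[OF im, of "3 * g + 1"] g by (simp add: add.assoc)
    ultimately have "6 * g * i + 3 * g + 1 \<in> doubled C"
      unfolding doubled_def mem_Collect_eq half_offset(4) using iC2 by blast
    moreover have "(6 * g * i + 3 * g + 1) div (6 * g) = i" using g by (intro half_div) auto
    ultimately show ?thesis by force
  qed (use im in \<open>simp add: pendants_def\<close>)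
qed

text \<open>The minimum is at most \<open>6 * g * m\<close>, so the excess is at most
  \<open>6 * \<epsilon> * g * m\<close>, which the bound on \<open>g\<close> turns into at most
  \<open>m / 1000\<close>.\<close>

lemma approx_cover_excess:
  assumes RB: "R \<subseteq> {..<m}" "B \<subseteq> {..<m}" "R = {} \<or> B = {}"
    and C: "approx_vertex_cover (1 + \<epsilon>) {..<n} (E R B) C" and \<epsilon>: "0 < \<epsilon>" "6000 * \<epsilon> * real g \<le> 1"
  shows "1000 * (card (doubled C) + card (pendants C)) \<le> m"
proof -
  define e where "e = card (doubled C) + card (pendants C)"
  have "vertex_cover {..<n} (E R B) C" using C by (simp add: approx_vertex_cover_def)
  then have "real (6 * g * m) + real e \<le> real (card C)"
    using card_cover_ge[of R B C] unfolding e_def by linarith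
  also have "\<dots> \<le> (1 + \<epsilon>) * real (min_vertex_cover_size {..<n} (E R B))"
    using C by (simp add: approx_vertex_cover_def)
  also have "\<dots> \<le> (1 + \<epsilon>) * real (6 * g * m)"
    using min_vertex_cover_size_le[OF RB] \<epsilon> by (intro mult_left_mono) (simp_all only: of_nat_le_iff)
  finally have "real e \<le> \<epsilon> * real (6 * g * m)" by (simp add: algebra_simps)
  then have "1000 * real e \<le> (6000 * \<epsilon> * real g) * real m" by (simp add: algebra_simps)
  also have "\<dots> \<le> 1 * real m" using \<epsilon> by (intro mult_right_mono) auto
  finally show ?thesis unfolding e_def[symmetric] by simp
qed

section \<open>Walks in the graph and moves between blocks\<close>

lemma pos_less_N: "x < N \<Longrightarrow> pos x = x" by (simp add: pos_def)

lemma chord_less_N: "chord p q \<Longrightarrow> p < N \<and> q < N"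
  unfolding chord_def using offset_less_N[OF _ offsets_less(1)] offset_less_N[OF pi_less W_pos]
  by (auto simp: add.assoc)

lemma chord_sym: "chord p q \<Longrightarrow> chord q p"
  unfolding chord_def by blast

lemma chord_endpoint: "chord p q \<Longrightarrow> \<exists>i a. p = W * i + a \<and> (a = 0 \<or> a = 6 * g + 1)"
  unfolding chord_def by (metis add.assoc add.right_neutral)

text \<open>Consecutive chord endpoints on the path are \<open>6 * g + 1\<close> or
  \<open>6 * g - 1\<close> apart.\<close>

lemma chord_endpoints_far:
  assumes "chord p q" "chord p' q'" "p < p' + 2 * g" "p' < p + 2 * g"
  shows "p = p'"
proof -
  have far: False if "p < p' + 2 * g" "p' < p + 2 * g" "p = W * i + a" "p' = W * j + b" "i < j"
      "a = 0 \<or> a = 6 * g + 1" for p p' i j a b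
  proof -
    have "W * Suc i \<le> W * j" using that by (intro mult_le_mono2) simp
    then have "W * i + 12 * g \<le> W * j" by (simp add: W_def)
    then show False using that g by linarith
  qed
  obtain i a where p: "p = W * i + a" "a = 0 \<or> a = 6 * g + 1" using chord_endpoint assms(1) by blast
  obtain j b where p': "p' = W * j + b" "b = 0 \<or> b = 6 * g + 1" using chord_endpoint assms(2) by blast
  have "i = j" using far[OF assms(3,4) p(1) p'(1)] far[OF assms(4,3) p'(1) p(1)] p(2) p'(2)
    by (cases i j rule: linorder_cases) auto
  then show ?thesis using p p' assms(3,4) by auto
qed

lemma chord_unique:
  assumes "chord p q" "chord p q'"
  shows "q = q'"
proof -
  have ne: "W * i + 6 * g + 1 \<noteq> W * j" for i j
    using offset_eqD[of i "6 * g + 1" j 0] offsets_less W_pos by (auto simp: add.assoc)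
  have eq: "W * i + 6 * g + 1 = W * j + 6 * g + 1 \<Longrightarrow> i = j" "W * i = W * j \<Longrightarrow> i = j" for i j
    using W_pos by simp_all
  show ?thesis using assms ne eq permutes_inj[OF \<pi>] unfolding chord_def by (metis injD)
qed

lemma edge_pos:
  assumes RB: "R \<subseteq> {..<m}" "B \<subseteq> {..<m}" and e: "{u, v} \<in> E R B"
  shows "\<bar>int (pos u) - int (pos v)\<bar> \<le> 2 \<or> chord u v"
  using e
proof (cases rule: edge_cases)
  case (5 i)
  then have "i < m" using RB by auto
  then show ?thesis using offset_less_N[of i "6 * g"] offsets_less 5 by (simp add: pos_def)
next
  case (6 i)
  then have "i < m" using RB by auto
  then show ?thesis using offset_less_N[of i "6 * g"] offsets_less 6 by (simp add: pos_def)
next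
  case (7 i)
  then have "i < m" using RB by auto
  then show ?thesis using offset_less_N[of i "6 * g + 3"] offsets_less 7 by (simp add: pos_def)
next
  case (8 i)
  then have "i < m" using RB by auto
  then show ?thesis using offset_less_N[of i "6 * g + 3"] offsets_less 8 by (simp add: pos_def)
qed (auto simp: pos_def chord_def)

text \<open>Chord endpoints are at distance more than \<open>2 * g\<close> from each other, so a walk of at most \<open>g\<close> steps
  uses essentially at most one chord.\<close>

lemma short_walk:
  assumes RB: "R \<subseteq> {..<m}" "B \<subseteq> {..<m}" and "(x, y) \<in> closed_adj (E R B) ^^ t" "t \<le> g"
  shows "\<bar>int (pos x) - int (pos y)\<bar> \<le> 2 * int t \<or>
    (\<exists>p q. chord p q \<and> \<bar>int (pos x) - int p\<bar> + \<bar>int (pos y) - int q\<bar> \<le> 2 * int t)"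
  using assms(3,4)
proof (induction t arbitrary: y)
  case (Suc t)
  then obtain w where w: "(x, w) \<in> closed_adj (E R B) ^^ t" "(w, y) \<in> closed_adj (E R B)" by auto
  have IH: "\<bar>int (pos x) - int (pos w)\<bar> \<le> 2 * int t \<or>
    (\<exists>p q. chord p q \<and> \<bar>int (pos x) - int p\<bar> + \<bar>int (pos w) - int q\<bar> \<le> 2 * int t)"
    using Suc w by auto
  have "y = w \<or> {w, y} \<in> E R B" using w(2) by (auto simp: closed_adj_def insert_commute)
  then have "\<bar>int (pos w) - int (pos y)\<bar> \<le> 2 \<or> chord w y" using edge_pos[OF RB] by auto
  then show ?case
  proof
    assume s: "\<bar>int (pos w) - int (pos y)\<bar> \<le> 2"
    from IH show ?thesis
    proof
      assume "\<bar>int (pos x) - int (pos w)\<bar> \<le> 2 * int t"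
      then have "\<bar>int (pos x) - int (pos y)\<bar> \<le> 2 * int (Suc t)" using s unfolding of_nat_Suc by (smt (verit))
      then show ?thesis by blast
    next
      assume "\<exists>p q. chord p q \<and> \<bar>int (pos x) - int p\<bar> + \<bar>int (pos w) - int q\<bar> \<le> 2 * int t"
      then obtain p q where pq: "chord p q" "\<bar>int (pos x) - int p\<bar> + \<bar>int (pos w) - int q\<bar> \<le> 2 * int t" by blast
      then have "\<bar>int (pos x) - int p\<bar> + \<bar>int (pos y) - int q\<bar> \<le> 2 * int (Suc t)" using s unfolding of_nat_Suc by (smt (verit))
      then show ?thesis using pq(1) by blast
    qed
  next
    assume c: "chord w y"
    have pw: "pos w = w" "pos y = y" using chord_less_N[OF c] pos_less_N by auto
    from IH show ?thesis
    proof
      assume "\<bar>int (pos x) - int (pos w)\<bar> \<le> 2 * int t"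
      then have "\<bar>int (pos x) - int w\<bar> + \<bar>int (pos y) - int y\<bar> \<le> 2 * int (Suc t)" using pw by simp
      then show ?thesis using c by blast
    next
      assume "\<exists>p q. chord p q \<and> \<bar>int (pos x) - int p\<bar> + \<bar>int (pos w) - int q\<bar> \<le> 2 * int t"
      then obtain p q where pq: "chord p q" "\<bar>int (pos x) - int p\<bar> + \<bar>int (pos w) - int q\<bar> \<le> 2 * int t" by blast
      \<comment> \<open>A second chord can only be the first one traversed back: \<open>w\<close> is
        too close to \<open>q\<close> to be another endpoint. The walk is then at \<open>p\<close>,
        and the alternative without a chord holds again.\<close>
      have "w < q + 2 * g" "q < w + 2 * g" using pq(2) Suc.prems(2) pw(1) by linarith+
      then have "w = q" by (rule chord_endpoints_far[OF c chord_sym[OF pq(1)]])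
      then have "y = p" using chord_unique c chord_sym[OF pq(1)] by blast
      then have "\<bar>int (pos x) - int (pos y)\<bar> \<le> 2 * int (Suc t)" using pq(2) pw unfolding of_nat_Suc by simp
      then show ?thesis by blast
    qed
  qed
qed simp

lemma near_div:
  assumes "\<bar>int a - int b\<bar> \<le> 2 * int g"
  shows "b div W \<in> near (a div W)"
proof -
  have *: "b div W \<in> near (a div W)" if "a \<le> b" "b \<le> a + W" for a b
  proof -
    have "b div W \<le> (a + W) div W" using that by (intro div_le_mono)
    then have "b div W \<le> a div W + 1" using W_pos by simp
    moreover have "a div W \<le> b div W" using that by (intro div_le_mono)
    ultimately show ?thesis by (auto simp: near_def)
  qed
  have "a \<le> b + W" "b \<le> a + W" using assms by (auto simp: W_def)
  then show ?thesis using *[of a b] near_sym[OF *[of b a]] by linarith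
qed

lemma blk_short_walk:
  assumes RB: "R \<subseteq> {..<m}" "B \<subseteq> {..<m}" and "(x, y) \<in> closed_adj (E R B) ^^ g"
  shows "(blk x, blk y) \<in> blk_rel"
  using short_walk[OF RB assms(3) order_refl]
proof
  assume "\<bar>int (pos x) - int (pos y)\<bar> \<le> 2 * int g"
  then have "blk y \<in> near (blk x)" unfolding blk_def by (rule near_div)
  moreover have "blk x \<in> near (blk x)" by (simp add: near_def)
  ultimately show ?thesis unfolding blk_rel_def by blast
next
  assume "\<exists>p q. chord p q \<and> \<bar>int (pos x) - int p\<bar> + \<bar>int (pos y) - int q\<bar> \<le> 2 * int g"
  then obtain p q where pq: "chord p q" "\<bar>int (pos x) - int p\<bar> + \<bar>int (pos y) - int q\<bar> \<le> 2 * int g" by blast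
  have "\<bar>int (pos x) - int p\<bar> \<le> 2 * int g" "\<bar>int (pos y) - int q\<bar> \<le> 2 * int g" using pq(2) by linarith+
  then have nr: "p div W \<in> near (blk x)" "blk y \<in> near (q div W)" unfolding blk_def using near_div near_sym by blast+
  have "q div W = \<pi> (p div W) \<or> p div W = \<pi> (q div W)"
    using pq(1) div_mod_offset(1)[OF offsets_less(1)] W_pos unfolding chord_def by (auto simp: add.assoc)
  then show ?thesis using nr unfolding blk_rel_def by blast
qed

text \<open>By reflexivity the walk can be padded to length \<open>g * k\<close>; it is then cut
  into \<open>k\<close> pieces of length \<open>g\<close>.\<close>

lemma blk_walk:
  assumes RB: "R \<subseteq> {..<m}" "B \<subseteq> {..<m}" and "(x, y) \<in> closed_adj (E R B) ^^ t" "t \<le> g * k"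
  shows "(blk x, blk y) \<in> blk_rel ^^ k"
proof -
  have "(x, y) \<in> closed_adj (E R B) ^^ (g * k)" using closed_adj_pow_mono[OF assms(4)] assms(3) by blast
  then show ?thesis
  proof (induction k arbitrary: y)
    case (Suc k)
    have "g * Suc k = g * k + g" by simp
    then obtain w where "(x, w) \<in> closed_adj (E R B) ^^ (g * k)" "(w, y) \<in> closed_adj (E R B) ^^ g"
      using Suc.prems by (auto simp only: relpow_add)
    then show ?case using Suc.IH blk_short_walk[OF RB] by auto
  qed simp
qed

lemma sym_blk_rel: "sym (blk_rel ^^ k)"
proof (rule sym_relpow, rule symI)
  fix b c assume "(b, c) \<in> blk_rel"
  then obtain b' c' where "b' \<in> near b" "c \<in> near c'" "c' = b' \<or> c' = \<pi> b' \<or> b' = \<pi> c'"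
    unfolding blk_rel_def by blast
  then have "c' \<in> near c" "b \<in> near b'" "b' = c' \<or> b' = \<pi> c' \<or> c' = \<pi> b'" using near_sym by auto
  then show "(c, b) \<in> blk_rel" unfolding blk_rel_def by blast
qed

text \<open>Three choices for each of the two shifts, and three for the move between them (staying,
  \<open>\<pi>\<close> or its inverse), give at most 27 blocks.\<close>

lemma card_blk_rel_image_le: "finite ((blk_rel ^^ k) `` {b}) \<and> card ((blk_rel ^^ k) `` {b}) \<le> 27 ^ k"
proof (rule card_relpow_image_le)
  fix b
  define F where "F b' = (\<Union>c'\<in>{b', \<pi> b', inv \<pi> b'}. near c')" for b'
  have sub: "blk_rel `` {b} \<subseteq> (\<Union>b'\<in>near b. F b')"
  proof
    fix c assume "c \<in> blk_rel `` {b}"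
    then obtain b' c' where *: "b' \<in> near b" "c \<in> near c'" "c' = b' \<or> c' = \<pi> b' \<or> b' = \<pi> c'"
      unfolding blk_rel_def by blast
    then have "c' \<in> {b', \<pi> b', inv \<pi> b'}" using permutes_inverses(2)[OF \<pi>] by auto
    then show "c \<in> (\<Union>b'\<in>near b. F b')" using * unfolding F_def by blast
  qed
  have "card (F b') \<le> card {b', \<pi> b', inv \<pi> b'} * 3" for b'
    unfolding F_def by (rule card_UN_le_mult) (auto simp: card_near_le)
  moreover have "card {b', \<pi> b', inv \<pi> b'} \<le> 3" for b' by (simp add: card_insert_if)
  ultimately have "card (F b') \<le> 9" for b' using order_trans[of "card (F b')" "card {b', \<pi> b', inv \<pi> b'} * 3" 9]
    by force
  then have "card (\<Union>b'\<in>near b. F b') \<le> card (near b) * 9" by (intro card_UN_le_mult finite_near)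
  also have "\<dots> \<le> 27" using card_near_le[of b] by simp
  finally have c: "card (\<Union>b'\<in>near b. F b') \<le> 27" .
  have f: "finite (\<Union>b'\<in>near b. F b')" unfolding F_def by (auto simp: finite_near)
  show "finite (blk_rel `` {b})" using sub f by (rule finite_subset)
  show "card (blk_rel `` {b}) \<le> 27" using card_mono[OF f sub] c by simp
qed

text \<open>The instances interpolate between all red pendants (at \<open>j = 0\<close>) and all blue ones (at \<open>j = 2 * m\<close>).\<close>

definition instance_edges :: "nat \<Rightarrow> nat set set" where
  "instance_edges j = E {..<m - j} {..<j - m}"

definition centre :: "nat \<Rightarrow> nat" where
  "centre i = W * i + 6 * g + 1"

lemma blk_centre: "i < m \<Longrightarrow> blk (centre i) = i"
  using offset_less_N[of i "6 * g + 1"] offsets_less(1) div_mod_offset(1)[OF offsets_less(1), of i]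
  by (simp add: blk_def pos_def centre_def add.assoc)

lemma centre_less: "i < m \<Longrightarrow> centre i < n"
  using offset_less_N[of i "6 * g + 1"] offsets_less(1) N_n by (simp add: centre_def)

lemma neighbours_insert_edge:
  assumes "i < m" "blk u \<noteq> i" "a < W"
  shows "neighbours (insert {N + i, W * i + a} F) u = neighbours F u"
proof -
  have "blk (N + i) = i"
    using div_mod_offset(1)[OF offsets_less(1), of i] by (simp add: blk_def pos_def add.assoc)
  moreover have "blk (W * i + a) = i"
    using offset_less_N[OF assms(1,3)] div_mod_offset(1)[OF assms(3)] by (simp add: blk_def pos_def)
  ultimately have "u \<notin> {N + i, W * i + a}" using assms(2) by auto
  then have "{v, u} \<noteq> {N + i, W * i + a}" for v by (metis insertCI)
  then show ?thesis by (auto simp: neighbours_def)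
qed

text \<open>While \<open>j < m\<close> a step removes one red pendant edge, and from
  \<open>m\<close> on it adds a blue one, so the colours never occur together. Both ends of the edge
  belong to its block.\<close>

lemma instance_edges_step:
  assumes "j < 2 * m"
  obtains i where "i < m" "\<And>u. blk u \<noteq> i \<Longrightarrow> neighbours (instance_edges (Suc j)) u = neighbours (instance_edges j) u"
proof (cases "j < m")
  case True
  define i where "i = m - Suc j"
  have i: "i < m" using True by (simp add: i_def)
  have "{..<m - j} = insert i {..<m - Suc j}" "{..<j - m} = {}" "{..<Suc j - m} = {}"
    using True by (auto simp: i_def)
  then have "instance_edges j = insert {N + i, W * i + 6 * g} (instance_edges (Suc j))"
    unfolding instance_edges_def E_def by auto
  then have "neighbours (instance_edges (Suc j)) u = neighbours (instance_edges j) u" if "blk u \<noteq> i" for u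
    using neighbours_insert_edge[OF i that offsets_less(2)] by simp
  then show ?thesis using that i by blast
next
  case False
  define i where "i = j - m"
  have i: "i < m" using False assms by (simp add: i_def)
  have "{..<Suc j - m} = insert i {..<j - m}" "{..<m - j} = {}" "{..<m - Suc j} = {}"
    using False by (auto simp: i_def)
  then have "instance_edges (Suc j) = insert {N + i, W * i + (6 * g + 3)} (instance_edges j)"
    unfolding instance_edges_def E_def by (auto simp: add.assoc)
  then have "neighbours (instance_edges (Suc j)) u = neighbours (instance_edges j) u" if "blk u \<noteq> i" for u
    using neighbours_insert_edge[OF i that offsets_less(3)] by simp
  then show ?thesis using that i by blast
qed

text \<open>The events counted in \<open>concentrated_count_no_jump\<close> say that a block is
  even. As \<open>k\<close> measures the running time in units of \<open>g\<close>, dependence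
  reaches only blocks within \<open>2 * k\<close> moves.\<close>

lemma no_fast_algorithm:
  assumes expanding: "\<And>S. S \<subseteq> {..<m} \<Longrightarrow> m \<le> 3 * card S \<Longrightarrow> 3 * card S \<le> 2 * m \<Longrightarrow>
        m < 1000 * card (path_cut m S) \<or> m < 1000 * card (\<pi> ` S - S)"
    and alg: "computes_approx_mvc A \<kappa> n T \<epsilon> p" "1 \<le> \<kappa>"
    and \<epsilon>: "0 < \<epsilon>" "6000 * \<epsilon> * real g \<le> 1" and p: "0 < p" "p \<le> 1"
    and T: "T \<le> g * k" and large: "144 * 27 ^ (2 * k) < p * real m"
  shows False
proof -
  define V where "V = {..<n}"
  define M where "M = node_coins V"
  define C where "C j \<omega> = computed_set A T V (instance_edges j) \<omega>" for j \<omega>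
  define Ev where "Ev j i = {\<omega> \<in> space M. centre i \<notin> C j \<omega>}" for j i
  define G where "G j = {\<omega> \<in> space M. approx_vertex_cover (1 + \<epsilon>) V (instance_edges j) (C j \<omega>)}" for j
  have M: "M = PiM V (\<lambda>_. coin_flips)" by (simp add: M_def node_coins_def)
  interpret P: prob_space M
    unfolding M by (intro prob_space_PiM prob_space_coin_flips)
  have sub: "{..<m - j} \<subseteq> {..<m}" "{..<j - m} \<subseteq> {..<m}" "{..<m - j} = {} \<or> {..<j - m} = {}" if "j \<le> 2 * m" for j
    using that by auto
  have centreV: "centre i \<in> V" if "i < m" for i using centre_less[OF that] by (simp add: V_def)
  have edgeV: "e \<subseteq> V" if "j \<le> 2 * m" "e \<in> instance_edges j" for j e
    using edge_in_V[OF sub(1,2)[OF that(1)] that(2)[unfolded instance_edges_def]] by (auto simp: V_def)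
  have correct: "(\<forall>v\<in>V. {\<omega> \<in> space M. v \<in> C j \<omega>} \<in> sets M) \<and> p \<le> P.prob (G j)" if j: "j \<le> 2 * m" for j
  proof -
    \<comment> \<open>The identifiers are the numbers below \<open>n\<close>, so
      \<open>1 <= \<kappa>\<close> puts them in the admissible range.\<close>
    have "n \<le> n ^ \<kappa>" using alg(2) by (cases "n = 0") (auto intro: self_le_power)
    then have "network \<kappa> n V (instance_edges j)"
      unfolding network_def V_def instance_edges_def using simple_graph_E[OF sub(1,2)[OF j]] by auto
    then show ?thesis
      using alg(1) bipartite_graph_E[OF sub[OF j]] max_degree_eq[OF sub[OF j]]
      unfolding computes_approx_mvc_def C_def G_def M_def V_def instance_edges_def by blast
  qed
  have reach_blk: "(i, blk u) \<in> blk_rel ^^ k"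
    if "j \<le> 2 * m" "i < m" "(centre i, u) \<in> closed_adj (instance_edges j) ^^ T" for i j u
    using blk_walk[OF sub(1,2)[OF that(1)] that(3)[unfolded instance_edges_def] T] blk_centre[OF that(2)] by simp
  have Ev: "Ev j i \<in> P.events" if "j \<le> 2 * m" "i < m" for i j
  proof -
    have "Ev j i = space M - {\<omega> \<in> space M. centre i \<in> C j \<omega>}" by (auto simp: Ev_def)
    then show ?thesis using correct[OF that(1)] centreV[OF that(2)] by auto
  qed
  \<comment> \<open>The outputs at two middles depend on the coins in their balls of radius
    \<open>T\<close>; a common node would put the two blocks within \<open>2 * k\<close> moves of
    each other.\<close>
  have indep: "P.prob (Ev j i \<inter> Ev j i') = P.prob (Ev j i) * P.prob (Ev j i')"
    if j: "j \<le> 2 * m" and i: "i < m" "i' < m" and far: "i' \<notin> (blk_rel ^^ (2 * k)) `` {i}" for i i' j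
  proof -
    define J where "J i = {u. (centre i, u) \<in> closed_adj (instance_edges j) ^^ T}" for i
    have JV: "J i \<subseteq> V" if "i < m" for i
      unfolding J_def using closed_adj_pow_in[OF _ centreV[OF that] edgeV[OF j]] by blast
    have dep: "\<omega>' \<in> Ev j i" if "\<omega>' \<in> space M" "\<And>u. u \<in> J i \<Longrightarrow> \<omega> u = \<omega>' u" "\<omega> \<in> Ev j i" for \<omega> \<omega>' i
      using computed_set_cong[where v = "centre i" and E = "instance_edges j" and E' = "instance_edges j"
          and T = T and \<omega> = \<omega> and \<omega>' = \<omega>' and A = A and V = V] that
      by (auto simp: Ev_def C_def J_def)
    have "J i \<inter> J i' = {}"
    proof (rule ccontr)
      assume "J i \<inter> J i' \<noteq> {}"
      then obtain u where "(i, blk u) \<in> blk_rel ^^ k" "(i', blk u) \<in> blk_rel ^^ k"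
        using reach_blk[OF j] i by (auto simp: J_def)
      then have "(i, i') \<in> blk_rel ^^ (k + k)"
        unfolding relpow_add using symD[OF sym_blk_rel] by blast
      then show False using far by (simp add: mult_2)
    qed
    then show ?thesis
      by (rule measure_Int_disjoint_coordinates[where I = V and N = "\<lambda>_. coin_flips", folded M,
            OF prob_space_coin_flips JV[OF i(1)] JV[OF i(2)] _ Ev[OF j i(1)] Ev[OF j i(2)]])
         (erule dep[rotated 2], assumption, blast)+
  qed
  \<comment> \<open>The ball around the middle of block \<open>i\<close> avoids the block
    \<open>i'\<close> of the changed edge, so the events themselves coincide, not only their
    probabilities.\<close>
  have unchanged: "Ev (Suc j) i = Ev j i"
    if j: "j < 2 * m" "i < m" and nb: "\<And>u. blk u \<noteq> i' \<Longrightarrow> neighbours (instance_edges (Suc j)) u = neighbours (instance_edges j) u"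
      and far: "(i, i') \<notin> blk_rel ^^ k" for i i' j
  proof -
    have "centre i \<in> C (Suc j) \<omega> \<longleftrightarrow> centre i \<in> C j \<omega>" for \<omega>
      unfolding C_def
    proof (rule computed_set_cong)
      fix u assume "(centre i, u) \<in> closed_adj (instance_edges (Suc j)) ^^ T"
      then have "(i, blk u) \<in> blk_rel ^^ k" using reach_blk[of "Suc j" i u] j by simp
      then have "blk u \<noteq> i'" using far by auto
      then show "neighbours (instance_edges (Suc j)) u = neighbours (instance_edges j) u \<and> \<omega> u = \<omega> u"
        using nb by simp
    qed
    then show ?thesis by (simp add: Ev_def)
  qed
  have count: "{i \<in> {..<m}. \<omega> \<in> Ev j i} = even_blocks (C j \<omega>)" if "\<omega> \<in> space M" for j \<omega>
    using that by (auto simp: Ev_def even_blocks_def centre_def)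
  have small: "vertex_cover {..<n} (E {..<m - j} {..<j - m}) (C j \<omega>)"
    "1000 * (card (doubled (C j \<omega>)) + card (pendants (C j \<omega>))) \<le> m" if "j \<le> 2 * m" "\<omega> \<in> G j" for j \<omega>
    using that approx_cover_excess[OF sub[OF that(1)] _ \<epsilon>, of "C j \<omega>"]
    by (auto simp: G_def V_def instance_edges_def approx_vertex_cover_def)
  have ebm: "even_blocks X \<subseteq> {..<m}" for X by (auto simp: even_blocks_def)
  show False
  proof (rule P.concentrated_count_no_jump[where A = Ev and n = "2 * m" and m = m and D = "27 ^ (2 * k)" and p = p and G = G])
    show "Ev j i \<in> P.events" if "j \<le> 2 * m" "i < m" for i j using Ev that .
    show "card {i' \<in> {..<m}. P.prob (Ev j i \<inter> Ev j i') \<noteq> P.prob (Ev j i) * P.prob (Ev j i')} \<le> 27 ^ (2 * k)"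
      if "j \<le> 2 * m" "i < m" for i j
    proof -
      have "{i' \<in> {..<m}. P.prob (Ev j i \<inter> Ev j i') \<noteq> P.prob (Ev j i) * P.prob (Ev j i')} \<subseteq> (blk_rel ^^ (2 * k)) `` {i}"
        using indep[OF that] by blast
      from card_mono[OF _ this] show ?thesis using card_blk_rel_image_le[of "2 * k" i] by linarith
    qed
    show "card {i \<in> {..<m}. Ev (Suc j) i \<noteq> Ev j i} \<le> 27 ^ (2 * k)" if j: "j < 2 * m" for j
    proof -
      obtain i' where i': "i' < m" "\<And>u. blk u \<noteq> i' \<Longrightarrow> neighbours (instance_edges (Suc j)) u = neighbours (instance_edges j) u"
        using instance_edges_step[OF j] by blast
      have "{i \<in> {..<m}. Ev (Suc j) i \<noteq> Ev j i} \<subseteq> (blk_rel ^^ k) `` {i'}"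
        using unchanged[OF j _ i'(2)] symD[OF sym_blk_rel] by blast
      from card_mono[OF _ this] have "card {i \<in> {..<m}. Ev (Suc j) i \<noteq> Ev j i} \<le> 27 ^ k"
        using card_blk_rel_image_le[of k i'] by linarith
      also have "\<dots> \<le> 27 ^ (2 * k)" by (intro power_increasing) auto
      finally show ?thesis .
    qed
    show "144 * real (27 ^ (2 * k)) < p * real m" using large by simp
    show "0 < m" "p \<le> 1" using m p by auto
    show "p \<le> P.prob (G j)" "G j \<subseteq> space M" if "j \<le> 2 * m" for j using correct[OF that] by (auto simp: G_def)
    show "3 * card {i \<in> {..<m}. \<omega> \<in> Ev j i} < m \<or> 2 * m < 3 * card {i \<in> {..<m}. \<omega> \<in> Ev j i}"
      if j: "j \<le> 2 * m" "\<omega> \<in> G j" for j \<omega>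
    proof -
      have "\<omega> \<in> space M" using j by (simp add: G_def)
      \<comment> \<open>Both cuts are at most the number of doubled edges, hence at most
        \<open>m / 1000\<close>, so expansion excludes a medium-sized set of even blocks.\<close>
      moreover have "\<not> (m < 1000 * card (path_cut m (even_blocks (C j \<omega>))) \<or>
          m < 1000 * card (\<pi> ` even_blocks (C j \<omega>) - even_blocks (C j \<omega>)))"
        using path_cut_even_blocks_le[OF small(1)[OF j]] permutation_cut_even_blocks_le[OF small(1)[OF j]]
          small(2)[OF j] by auto
      ultimately show ?thesis using expanding[OF ebm, of "C j \<omega>"] count[of \<omega> j] by (metis not_le)
    qed
    show "2 * m < 3 * card {i \<in> {..<m}. \<omega> \<in> Ev 0 i}" if w: "\<omega> \<in> G 0" for \<omega>
    proof -
      have sp: "\<omega> \<in> space M" using w by (simp add: G_def)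
      \<comment> \<open>Every block of instance \<open>0\<close> has a red pendant edge, so all but
        at most \<open>m / 1000\<close> blocks are even.\<close>
      have "card ({..<m} - even_blocks (C 0 \<omega>)) \<le> card (doubled (C 0 \<omega>)) + card (pendants (C 0 \<omega>))"
        using red_cut_le[OF small(1)[OF le0 w]] by simp
      moreover have "card ({..<m} - even_blocks (C 0 \<omega>)) = m - card (even_blocks (C 0 \<omega>))"
        by (subst card_Diff_subset) (use ebm in \<open>auto intro: finite_subset\<close>)
      ultimately show ?thesis unfolding count[OF sp] using small(2)[OF le0 w] m by auto
    qed
    show "3 * card {i \<in> {..<m}. \<omega> \<in> Ev (2 * m) i} < m" if w: "\<omega> \<in> G (2 * m)" for \<omega>
    proof -
      have sp: "\<omega> \<in> space M" using w by (simp add: G_def)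
      have "{..<2 * m - m} \<inter> even_blocks (C (2 * m) \<omega>) = even_blocks (C (2 * m) \<omega>)" using ebm by auto
      then have "card (even_blocks (C (2 * m) \<omega>)) \<le> card (doubled (C (2 * m) \<omega>)) + card (pendants (C (2 * m) \<omega>))"
        using blue_cut_le[OF small(1)[OF order_refl w]] sub(2) by simp
      then show ?thesis unfolding count[OF sp] using small(2)[OF order_refl w] m by auto
    qed
  qed
qed

end

section \<open>The lower bound\<close>

text \<open>By \<open>27 <= exp 4\<close> the factor \<open>27 powr (ln x / 8)\<close> is at most
  \<open>sqrt x\<close>; the summand \<open>1\<close> in the bound on \<open>k\<close> costs
  \<open>27 ^ 2 = 729\<close>.\<close>

lemma power_27_le_sqrt:
  fixes x :: real
  assumes "1 \<le> x" "real k \<le> ln x / 16 + 1"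
  shows "27 ^ (2 * k) \<le> 729 * sqrt x"
proof -
  have "(5 / 2 :: real) \<le> exp 1" using exp_ge_one_plus_x_over_n_power_n[of 2 "1::real"] exp_lower_Taylor_quadratic[of "1::real"] by simp
  then have "(5 / 2) ^ 4 \<le> (exp 1 :: real) ^ 4" by (rule power_mono) simp
  also have "\<dots> = exp 4" by (simp flip: exp_of_nat_mult)
  finally have "27 \<le> exp (4::real)" by (simp add: power_divide)
  then have ln27: "ln 27 \<le> (4::real)" by (metis exp_le_cancel_iff exp_ln zero_less_numeral)
  have "(27::real) ^ (2 * k) = 27 powr (2 * real k)" by (simp flip: powr_realpow)
  also have "\<dots> \<le> 27 powr (ln x / 8 + 2)" using assms(2) by (intro powr_mono) auto
  also have "\<dots> = 729 * 27 powr (ln x / 8)" by (simp add: powr_add)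
  also have "27 powr (ln x / 8) = exp (ln x / 8 * ln 27)" by (simp add: powr_def)
  also have "\<dots> \<le> exp (ln x / 8 * 4)"
    using assms(1) ln27 by (subst exp_le_cancel_iff) (intro mult_left_mono, auto)
  also have "\<dots> = x powr (1 / 2)" using assms(1) by (simp add: powr_def)
  also have "\<dots> = sqrt x" using assms(1) by (simp add: powr_half_sqrt)
  finally show ?thesis by simp
qed

theorem theorem1p5:
  shows "\<exists>\<epsilon>\<^sub>0::real. \<epsilon>\<^sub>0 > 0 \<and> (\<exists>c::real. c > 0 \<and>
    (\<forall>\<epsilon>::real. 0 < \<epsilon> \<and> \<epsilon> \<le> \<epsilon>\<^sub>0 \<longrightarrow>
      (\<forall>(p::real) (k::nat) (A::local_algorithm) (T::nat \<Rightarrow> nat).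
        0 < p \<and> p \<le> 1 \<and> 1 \<le> k \<and> (\<forall>n. computes_approx_mvc A k n (T n) \<epsilon> p) \<longrightarrow>
        (\<forall>\<^sub>F n in sequentially. c * (ln (real n) / \<epsilon>) \<le> real (T n)))))"
proof (rule exI[of _ "1 / 6000"], rule conjI, simp, rule exI[of _ "1 / 192000"], rule conjI, simp, intro allI impI, elim conjE)
  fix \<epsilon> p :: real and \<kappa> :: nat and A :: local_algorithm and T :: "nat \<Rightarrow> nat"
  assume \<epsilon>: "0 < \<epsilon>" "\<epsilon> \<le> 1 / 6000" and p: "0 < p" "p \<le> 1" and \<kappa>: "1 \<le> \<kappa>"
    and alg: "\<forall>n. computes_approx_mvc A \<kappa> n (T n) \<epsilon> p"
  \<comment> \<open>The bound on \<open>\<epsilon>\<close> gives \<open>x >= 1\<close>, so rounding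
    down leaves \<open>g\<close> positive and loses at most a factor 2:
    \<open>6000 * \<epsilon> * g\<close> lies between \<open>1 / 2\<close> and
    \<open>1\<close>.\<close>
  define x where "x = 1 / (6000 * \<epsilon>)"
  define g where "g = nat \<lfloor>x\<rfloor>"
  have x: "1 \<le> x" using \<epsilon> by (simp add: x_def field_simps)
  then have "0 < \<lfloor>x\<rfloor>" by simp
  then have g: "0 < g" and gx: "real g \<le> x" "x < real g + 1" unfolding g_def by linarith+
  have "6000 * \<epsilon> * real g \<le> 6000 * \<epsilon> * x" using gx \<epsilon> by (intro mult_left_mono) auto
  then have g_upper: "6000 * \<epsilon> * real g \<le> 1" using \<epsilon> by (simp add: x_def)
  have "x \<le> 2 * real g" using g gx by linarith
  then have "6000 * \<epsilon> * x \<le> 6000 * \<epsilon> * (2 * real g)" using \<epsilon> by (intro mult_left_mono) auto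
  then have g_lower: "1 \<le> 12000 * \<epsilon> * real g" using \<epsilon> by (simp add: x_def)
  \<comment> \<open>A block uses \<open>12 * g\<close> path nodes and one pendant node, so about
    \<open>a * n\<close> blocks fit; \<open>a\<close> is constant in \<open>n\<close> because
    \<open>\<epsilon>\<close> is fixed.\<close>
  define a where "a = 1 / real (12 * g + 1)"
  have a: "0 < a" by (simp add: a_def)
  have "\<forall>\<^sub>F n in sequentially. 501 \<le> a * real n" using a by real_asymp
  \<comment> \<open>The dependence bound grows like the square root of \<open>n\<close>, the number
    of blocks linearly.\<close>
  moreover have "\<forall>\<^sub>F n in sequentially. 144 * (729 * sqrt (real n)) < p * (a * real n - 1)"
    using a p(1) by real_asymp
  ultimately show "\<forall>\<^sub>F n in sequentially. 1 / 192000 * (ln (real n) / \<epsilon>) \<le> real (T n)"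
    using eventually_ge_at_top[of 1]
  proof eventually_elim
    case (elim n)
    show ?case
    proof (rule ccontr)
      assume fast: "\<not> ?thesis"
      define m where "m = n div (12 * g + 1)"
      define k where "k = T n div g + 1"
      have ma: "a * real n - 1 \<le> real m"
      proof -
        have "real n / real (12 * g + 1) - 1 \<le> real m"
          unfolding m_def using floor_divide_of_nat_eq[of n "12 * g + 1", where 'a = real] by linarith
        then show ?thesis by (simp add: a_def)
      qed
      then have m: "500 \<le> m" using elim(1) by linarith
      have Tk: "T n \<le> g * k" unfolding k_def using g
        by (metis Suc_eq_plus1 dividend_less_times_div less_or_eq_imp_le mult.commute mult_Suc_right add.commute)
      have "real k \<le> ln (real n) / 16 + 1"
      proof -
        have "real (T n div g) \<le> real (T n) / real g" by (rule of_nat_div_le_of_nat)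
        also have "\<dots> \<le> ln (real n) / 16"
        proof -
          \<comment> \<open>Here \<open>192000 = 12000 * 16\<close>: the factor \<open>12000\<close>
            is absorbed by \<open>g_lower\<close>, and \<open>16\<close> is the divisor that
            \<open>power_27_le_sqrt\<close> asks for.\<close>
          have "real (T n) * \<epsilon> \<le> ln (real n) / 192000" using fast \<epsilon> by (simp add: field_simps)
          then have "12000 * (real (T n) * \<epsilon>) \<le> ln (real n) / 16" by simp
          then have "12000 * (real (T n) * \<epsilon>) * real g \<le> ln (real n) / 16 * real g" by (intro mult_right_mono) auto
          moreover have "real (T n) * 1 \<le> real (T n) * (12000 * \<epsilon> * real g)" using g_lower by (intro mult_left_mono) auto
          ultimately have "real (T n) \<le> ln (real n) / 16 * real g" by (simp add: mult_ac)
          then show ?thesis using g by (simp add: divide_le_eq)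
        qed
        finally show ?thesis by (simp add: k_def)
      qed
      then have "27 ^ (2 * k) \<le> 729 * sqrt (real n)" using elim(3) by (intro power_27_le_sqrt) auto
      then have "144 * 27 ^ (2 * k) < p * (a * real n - 1)" using elim(2) by linarith
      also have "\<dots> \<le> p * real m" using ma p by (intro mult_left_mono) auto
      finally have large: "144 * 27 ^ (2 * k) < p * real m" .
      obtain \<pi> where \<pi>: "\<pi> permutes {..<m}" and expanding: "\<forall>S\<subseteq>{..<m}. m \<le> 3 * card S \<and> 3 * card S \<le> 2 * m \<longrightarrow>
          m < 1000 * card (path_cut m S) \<or> m < 1000 * card (\<pi> ` S - S)"
        using exists_expanding_permutation[OF m] by blast
      have "(12 * g + 1) * m \<le> n" unfolding m_def by (rule times_div_less_eq_dividend)
      then interpret chorded_path g m n \<pi>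
        using g m \<pi> by unfold_locales (auto simp: algebra_simps)
      show False
        using no_fast_algorithm[OF _ alg[rule_format] \<kappa> \<epsilon>(1) g_upper p Tk large] expanding by blast
    qed
  qed
qed

end
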